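(* For every $n\ge0$, define $$a_n:=\sum_{\alpha\in\mathcal G_{\min}}\binom{|\alpha|}{n-H(\alpha)}(-1)^{H(\alpha)}.$$ Then for every $0\le q<\frac{\sqrt2-1}{2}$ we have $$C(1-q)=\sum_{n\ge0}(-1)^n a_n q^n.$$
   Context: $C(p)$: for $p\in(0,1]$, the Barak-Erdős graph $\vec G(\mathbb Z,p)$ has vertex set $\mathbb Z$ and, for each $i<j$, an edge directed from $i$ to $j$ with probability $p$, independently over pairs. If $L_n$ is the maximal length (number of edges) of directed paths with endpoints in $\{1,\ldots,n\}$, then $C(p)$ is the deterministic a.s. limit of $L_n/n$ (known to exist). Configurations: maps $X:\mathbb Z\to\{0,1,2,\ldots\}\cup\{\infty\}$ for which there is $f\in\mathbb Z$ with $X(k)=0\iff k>f$; $\mathbb S$ is the set of configurations and $F(X):=\max\{k:X(k)>0\}$. For $\xi\in\mathbb N=\{1,2,\ldots\}$, $B(X,\xi):=\inf\{k:\sum_{j>k}X(j)<\xi\}$ and $\Phi_\xi(X):=X+\delta_{B(X,\xi)+1}$, where $\delta_k$ is $1$ at $k$ and $0$ elsewhere. Words: a selection word is a nonempty finite sequence $\alpha=\alpha_\ell\cdots\alpha_1$ of elements of $\mathbb N$, written from right to left; its length is $|\alpha|=\ell$ and its height is $H(\alpha)=\sum_{i=1}^{\ell}(\alpha_i-1)$. It acts on configurations by $\alpha X:=\Phi_{\alpha_\ell}\circ\cdots\circ\Phi_{\alpha_1}(X)$ (the empty word acts as the identity). The word $\alpha$ is good if $F(\alpha_\ell\alpha_{\ell-1}\cdots\alpha_1X)=F(\alpha_{\ell-1}\cdots\alpha_1X)+1$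 for all $X\in\mathbb S$. $\mathcal G$ is the set of good words and $\mathcal G_{\min}$ is the set of $\alpha=\alpha_\ell\cdots\alpha_1\in\mathcal G$ such that $\alpha_\ell\cdots\alpha_i\notin\mathcal G$ for all $i=2,\ldots,\ell$. Convention: for $\ell\in\mathbb N$ and $k\in\mathbb Z$, $\binom{\ell}{k}=0$ if $k<0$ or $k>\ell$. (The sum defining $a_n$ has only finitely many nonzero terms.) *)

theory Defs
  imports "HOL-Probability.Probability" "HOL-Library.Extended_Nat" "Graph_Theory.Arc_Walk"
begin

section \<open>The growth rate of the longest path in the Barak-Erdos graph\<close>

text \<open>
  An outcome \<open>\<omega>\<close> says, for every pair \<open>(i, j)\<close> with \<open>i < j\<close>, whether the edge from \<open>i\<close> to \<open>j\<close>
  is present; under \<open>barak_erdos_space p\<close> these are independent Bernoulli variables.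
\<close>

definition barak_erdos_space :: "real \<Rightarrow> (int \<times> int \<Rightarrow> bool) measure" where
  "barak_erdos_space p = PiM {(i, j). i < j} (\<lambda>_. measure_pmf (bernoulli_pmf p))"

definition barak_erdos_graph :: "(int \<times> int \<Rightarrow> bool) \<Rightarrow> (int, int \<times> int) pre_digraph" where
  "barak_erdos_graph \<omega> =
     \<lparr>verts = UNIV, arcs = {(i, j). i < j \<and> \<omega> (i, j)}, tail = fst, head = snd\<rparr>"

text \<open>
  A path is represented by the list of its arcs, so its length is the number of edges. For
  \<open>n \<ge> 1\<close> the set below is finite and contains \<open>0\<close>; for \<open>n = 0\<close> it is empty and the value is
  irrelevant.
\<close>

definition longest_path :: "(int \<times> int \<Rightarrow> bool) \<Rightarrow> nat \<Rightarrow> nat" where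
  "longest_path \<omega> n =
     Max {length \<pi> | u \<pi> v. u \<in> {1..int n} \<and> v \<in> {1..int n}
            \<and> pre_digraph.apath (barak_erdos_graph \<omega>) u \<pi> v}"

definition growth_rate :: "real \<Rightarrow> real" where
  "growth_rate p = (THE c. AE \<omega> in barak_erdos_space p.
                   (\<lambda>n. real (longest_path \<omega> n) / real n) \<longlonglongrightarrow> c)"


section \<open>The infinite bin model\<close>

definition configs :: "(int \<Rightarrow> enat) set" where
  "configs = {X. \<exists>f. \<forall>k. X k = 0 \<longleftrightarrow> k > f}"

definition front :: "(int \<Rightarrow> enat) \<Rightarrow> int" where
  "front X = (GREATEST k. X k > 0)"

text \<open>
  The sum over all \<open>j > k\<close> is written as a sum over the nonzero terms, which are finitely many
  when \<open>X\<close> is a configuration. For \<open>\<xi> \<ge> 1\<close> the infimum is then over a nonempty set of integers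
  that is bounded below.
\<close>

definition bin_index :: "(int \<Rightarrow> enat) \<Rightarrow> nat \<Rightarrow> int" where
  "bin_index X \<xi> = Inf {k. (\<Sum>j\<in>{j. j > k \<and> X j \<noteq> 0}. X j) < enat \<xi>}"

definition bin_move :: "nat \<Rightarrow> (int \<Rightarrow> enat) \<Rightarrow> (int \<Rightarrow> enat)" where
  "bin_move \<xi> X = (\<lambda>k. X k + (if k = bin_index X \<xi> + 1 then 1 else 0))"


section \<open>Words\<close>

text \<open>
  The word \<open>\<alpha>\<^sub>\<ell> \<dots> \<alpha>\<^sub>1\<close> is the list \<open>[\<alpha>\<^sub>\<ell>, \<dots>, \<alpha>\<^sub>1]\<close>, in the order in which it is written: the head
  of the list is the letter that acts last, and \<open>tl \<alpha>\<close> is \<open>\<alpha>\<^bsub>\<ell>-1\<^esub> \<dots> \<alpha>\<^sub>1\<close>.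
\<close>

definition selection_word :: "nat list \<Rightarrow> bool" where
  "selection_word \<alpha> \<longleftrightarrow> \<alpha> \<noteq> [] \<and> (\<forall>x\<in>set \<alpha>. x \<ge> 1)"

definition height :: "nat list \<Rightarrow> nat" where
  "height \<alpha> = (\<Sum>x\<leftarrow>\<alpha>. x - 1)"

definition act :: "nat list \<Rightarrow> (int \<Rightarrow> enat) \<Rightarrow> (int \<Rightarrow> enat)" where
  "act \<alpha> X = foldr bin_move \<alpha> X"

definition good_words :: "nat list set" where
  "good_words =
     {\<alpha>. selection_word \<alpha> \<and> (\<forall>X\<in>configs. front (act \<alpha> X) = front (act (tl \<alpha>) X) + 1)}"

text \<open>The word \<open>\<alpha>\<^sub>\<ell> \<dots> \<alpha>\<^sub>i\<close> consists of the first \<open>\<ell> - i + 1\<close> entries of the list.\<close>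

definition min_good_words :: "nat list set" where
  "min_good_words =
     {\<alpha> \<in> good_words. \<forall>i\<in>{2..length \<alpha>}. take (length \<alpha> - i + 1) \<alpha> \<notin> good_words}"


section \<open>The coefficients\<close>

definition binom :: "nat \<Rightarrow> int \<Rightarrow> nat" where
  "binom l k = (if k < 0 then 0 else l choose nat k)"

text \<open>
  The sum over \<open>min_good_words\<close> is written as a sum over its nonzero terms, which are finitely
  many for every \<open>n\<close>.
\<close>

definition series_coeff :: "nat \<Rightarrow> int" where
  "series_coeff n = (\<Sum>\<alpha>\<in>{\<alpha> \<in> min_good_words. binom (length \<alpha>) (int n - int (height \<alpha>)) \<noteq> 0}.
            int (binom (length \<alpha>) (int n - int (height \<alpha>))) * (-1) ^ height \<alpha>)"

end

theory Submission
  imports Defs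
begin

text \<open>
  Placing vertex \<open>n\<close> of the graph in the bin given by the length of the longest path that ends there
  turns the graph into an infinite bin model whose letters are independent and geometric, since the
  letter of a vertex is the rank, among the smaller vertices ordered by decreasing bin, of its first
  predecessor. Thus \<open>C(1 - q)\<close> is the frequency of the steps that move the front.

  If the last letters form a word \<open>\<beta>\<close> with \<open>H(\<beta>) < |\<beta>|\<close>, then by the cycle lemma some \<open>\<beta>\<^sub>\<ell> \<dots> \<beta>\<^sub>i\<close> has
  positive partial sums of \<open>2 - \<beta>\<^sub>j\<close>, and such a word decides whether the front moves, whatever
  came before. So the front moves iff the past ends with a minimal good word, up to an event whose
  probability decays exponentially in the length of the observed past, and a law of large numbers gives
  \<open>C(1 - q) = \<Sum>\<^sub>\<alpha> (1 - q)\<^bsup>|\<alpha>|\<^esup> q\<^bsup>H(\<alpha>)\<^esup>\<close>, the sum over the minimal good words. The same argument shows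
  \<open>|\<alpha>| \<le> H(\<alpha>) + 1\<close> for these words, which makes \<open>\<Sum>\<^sub>\<alpha> (1 + q)\<^bsup>|\<alpha>|\<^esup> q\<^bsup>H(\<alpha>)\<^esup>\<close> finite as soon as
  \<open>4q(1 + q) < 1\<close>, so the powers of \<open>1 - q\<close> may be expanded and the terms rearranged.
\<close>

section \<open>Moves and the depth of the selected bin\<close>

text \<open>The selected bin is counted back from the front, so that configurations with different
  fronts can be compared; at depth \<open>0\<close> the front moves.\<close>

definition depth :: "(int \<Rightarrow> enat) \<Rightarrow> nat \<Rightarrow> nat" where
  "depth X \<xi> = (LEAST d. enat \<xi> \<le> (\<Sum>i\<le>d. X (front X - int i)))"

lemma configs_eq_0_iff: "X \<in> configs \<Longrightarrow> X k = 0 \<longleftrightarrow> k > front X"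
proof -
  assume "X \<in> configs"
  then obtain f where f: "\<And>k. X k = 0 \<longleftrightarrow> k > f" by (auto simp: configs_def)
  have "front X = f"
    unfolding front_def by (rule Greatest_equality) (use f in \<open>auto simp: zero_less_iff_neq_zero not_less\<close>)
  then show ?thesis using f by simp
qed

lemma configs_le_front: "X \<in> configs \<Longrightarrow> X k \<noteq> 0 \<Longrightarrow> k \<le> front X"
  by (simp add: configs_eq_0_iff)

lemma front_eqI: "(\<And>k. X k = 0 \<longleftrightarrow> k > f) \<Longrightarrow> X \<in> configs \<and> front X = f"
  using configs_eq_0_iff[of X] by (auto simp: configs_def) (metis linorder_neqE_linordered_idom not_less_iff_gr_or_eq)

lemma configs_ge_1: "X \<in> configs \<Longrightarrow> 1 \<le> X (front X - int i)"
  using configs_eq_0_iff[of X "front X - int i"] by (simp add: ileI1 one_eSuc zero_less_iff_neq_zero)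

text \<open>A configuration has no empty bin up to its front, so the nonzero bins above
  \<open>front X - d\<close> are exactly the top \<open>d\<close> ones.\<close>

lemma tail_sum_eq:
  assumes "X \<in> configs"
  shows "(\<Sum>j\<in>{j. j > front X - int d \<and> X j \<noteq> 0}. X j) = (\<Sum>i<d. X (front X - int i))"
proof -
  have "{j. j > front X - int d \<and> X j \<noteq> 0} = (\<lambda>i. front X - int i) ` {..<d}"
  proof (intro equalityI subsetI)
    fix j assume "j \<in> {j. j > front X - int d \<and> X j \<noteq> 0}"
    then have "j > front X - int d" "j \<le> front X" using configs_eq_0_iff[OF assms, of j] by auto
    then have "nat (front X - j) < d" "j = front X - int (nat (front X - j))" by linarith+
    then show "j \<in> (\<lambda>i. front X - int i) ` {..<d}" by (metis image_eqI lessThan_iff)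
  next
    fix j assume "j \<in> (\<lambda>i. front X - int i) ` {..<d}"
    then obtain i where "i < d" "j = front X - int i" by auto
    then show "j \<in> {j. j > front X - int d \<and> X j \<noteq> 0}"
      using configs_eq_0_iff[OF assms, of j] by simp
  qed
  moreover have "inj_on (\<lambda>i. front X - int i) {..<d}" by (auto simp: inj_on_def)
  ultimately show ?thesis by (simp add: sum.reindex)
qed

text \<open>Tail sums decrease as the threshold rises, so the set under the infimum is upward closed
  and testing \<open>v\<close> and \<open>v - 1\<close> locates its least element.\<close>

lemma bin_index_eqI:
  assumes X: "X \<in> configs"
    and lt: "(\<Sum>j\<in>{j. j > v \<and> X j \<noteq> 0}. X j) < enat \<xi>"
    and ge: "enat \<xi> \<le> (\<Sum>j\<in>{j. j > v - 1 \<and> X j \<noteq> 0}. X j)"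
  shows "bin_index X \<xi> = v"
proof -
  have fin: "finite {j. j > k \<and> X j \<noteq> 0}" for k
    by (rule finite_subset[of _ "{k..front X}"]) (auto dest: configs_le_front[OF X])
  have mono: "(\<Sum>j\<in>{j. j > k \<and> X j \<noteq> 0}. X j) \<le> (\<Sum>j\<in>{j. j > l \<and> X j \<noteq> 0}. X j)" if "l \<le> k" for k l
    by (rule sum_mono2[OF fin]) (use that in auto)
  have "{k. (\<Sum>j\<in>{j. j > k \<and> X j \<noteq> 0}. X j) < enat \<xi>} = {v..}"
  proof (intro equalityI subsetI)
    fix k assume k: "k \<in> {k. (\<Sum>j\<in>{j. j > k \<and> X j \<noteq> 0}. X j) < enat \<xi>}"
    show "k \<in> {v..}"
    proof (rule ccontr)
      assume "k \<notin> {v..}"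
      then have "k \<le> v - 1" by auto
      from mono[OF this] ge k show False by auto
    qed
  next
    fix k assume "k \<in> {v..}"
    then have "v \<le> k" by simp
    from mono[OF this] lt show "k \<in> {k. (\<Sum>j\<in>{j. j > k \<and> X j \<noteq> 0}. X j) < enat \<xi>}" by auto
  qed
  then show ?thesis unfolding bin_index_def by simp
qed

lemma top_sum_ge: "X \<in> configs \<Longrightarrow> enat d \<le> (\<Sum>i<d. X (front X - int i))"
proof (induction d)
  case (Suc d)
  have "enat (Suc d) = enat d + 1" by (simp add: one_enat_def)
  also have "\<dots> \<le> (\<Sum>i<d. X (front X - int i)) + X (front X - int d)"
    using Suc configs_ge_1 by (intro add_mono) auto
  finally show ?case by simp
qed (simp add: zero_enat_def)

text \<open>\<open>LEAST\<close> is attained because the top \<open>\<xi> + 1\<close> nonempty bins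
  hold enough balls; monotone partial sums turn the minimum into a threshold test.\<close>

lemma depth_le_iff:
  assumes "X \<in> configs"
  shows "depth X \<xi> \<le> d \<longleftrightarrow> enat \<xi> \<le> (\<Sum>i\<le>d. X (front X - int i))"
proof
  assume "depth X \<xi> \<le> d"
  have "enat \<xi> \<le> (\<Sum>i<Suc \<xi>. X (front X - int i))"
    by (rule order_trans[OF _ top_sum_ge[OF assms]]) simp
  then have "enat \<xi> \<le> (\<Sum>i\<le>\<xi>. X (front X - int i))" by (simp only: lessThan_Suc_atMost)
  then have "enat \<xi> \<le> (\<Sum>i\<le>depth X \<xi>. X (front X - int i))"
    unfolding depth_def by (rule LeastI)
  also have "\<dots> \<le> (\<Sum>i\<le>d. X (front X - int i))"
    by (rule sum_mono2) (use \<open>depth X \<xi> \<le> d\<close> in auto)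
  finally show "enat \<xi> \<le> (\<Sum>i\<le>d. X (front X - int i))" .
next
  assume "enat \<xi> \<le> (\<Sum>i\<le>d. X (front X - int i))"
  then show "depth X \<xi> \<le> d" unfolding depth_def by (rule Least_le)
qed

lemma depth_less:
  assumes "X \<in> configs" "\<xi> \<ge> 1"
  shows "depth X \<xi> < \<xi>"
proof -
  have "enat \<xi> \<le> (\<Sum>i<Suc (\<xi> - 1). X (front X - int i))"
    using assms top_sum_ge[of X \<xi>] by simp
  then have "depth X \<xi> \<le> \<xi> - 1"
    using assms by (simp only: depth_le_iff lessThan_Suc_atMost)
  then show ?thesis using assms by simp
qed

lemma bin_index_depth:
  assumes X: "X \<in> configs" and "\<xi> \<ge> 1"
  shows "bin_index X \<xi> = front X - int (depth X \<xi>)"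
proof (rule bin_index_eqI[OF X])
  show "(\<Sum>j\<in>{j. j > front X - int (depth X \<xi>) \<and> X j \<noteq> 0}. X j) < enat \<xi>"
  proof (cases "depth X \<xi>")
    case 0
    then show ?thesis using tail_sum_eq[OF X, of 0] \<open>\<xi> \<ge> 1\<close> by (simp add: zero_enat_def)
  next
    case (Suc d)
    then have "\<not> depth X \<xi> \<le> d" by simp
    then show ?thesis unfolding depth_le_iff[OF X]
      using tail_sum_eq[OF X, of "Suc d"] Suc by (simp add: lessThan_Suc_atMost)
  qed
  have "enat \<xi> \<le> (\<Sum>i<Suc (depth X \<xi>). X (front X - int i))"
    using depth_le_iff[OF X, of \<xi> "depth X \<xi>"] by (simp add: lessThan_Suc_atMost)
  then show "enat \<xi> \<le> (\<Sum>j\<in>{j. j > front X - int (depth X \<xi>) - 1 \<and> X j \<noteq> 0}. X j)"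
    using tail_sum_eq[OF X, of "Suc (depth X \<xi>)"] by (simp add: algebra_simps)
qed

text \<open>The ball lands one bin above the selected one: in a new bin if the front bin is
  selected, in an occupied bin otherwise.\<close>

lemma bin_move_front:
  assumes X: "X \<in> configs" and "\<xi> \<ge> 1"
  shows "bin_move \<xi> X \<in> configs"
    and "front (bin_move \<xi> X) = front X + (if depth X \<xi> = 0 then 1 else 0)"
proof -
  have "bin_move \<xi> X k = 0 \<longleftrightarrow> k > front X + (if depth X \<xi> = 0 then 1 else 0)" for k
    using configs_eq_0_iff[OF X, of k] unfolding bin_move_def bin_index_depth[OF assms] by auto
  then have "bin_move \<xi> X \<in> configs \<and> front (bin_move \<xi> X) = front X + (if depth X \<xi> = 0 then 1 else 0)"
    by (rule front_eqI)
  then show "bin_move \<xi> X \<in> configs"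
    and "front (bin_move \<xi> X) = front X + (if depth X \<xi> = 0 then 1 else 0)" by blast+
qed

lemma act_Nil [simp]: "act [] X = X" and act_Cons [simp]: "act (x # \<alpha>) X = bin_move x (act \<alpha> X)"
  by (simp_all add: act_def)

lemma act_append: "act (\<alpha> @ \<beta>) X = act \<alpha> (act \<beta> X)"
  by (simp add: act_def)

lemma act_configs: "X \<in> configs \<Longrightarrow> 0 \<notin> set \<alpha> \<Longrightarrow> act \<alpha> X \<in> configs"
  by (induction \<alpha>) (auto intro!: bin_move_front)

section \<open>Words that determine the motion of the front\<close>

definition agree :: "nat \<Rightarrow> (int \<Rightarrow> enat) \<Rightarrow> (int \<Rightarrow> enat) \<Rightarrow> bool" where
  "agree d X Y \<longleftrightarrow> (\<forall>i<d. X (front X - int i) = Y (front Y - int i))"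

lemma agree_sym: "agree d X Y \<Longrightarrow> agree d Y X"
  by (simp add: agree_def)

lemma agree_mono: "agree d X Y \<Longrightarrow> e \<le> d \<Longrightarrow> agree e X Y"
  by (simp add: agree_def)

text \<open>Whether the depth is at most \<open>e\<close> is read off the top \<open>e + 1\<close>
  bins, which agree for \<open>e < d\<close>.\<close>

lemma agree_depth:
  assumes "X \<in> configs" "Y \<in> configs" "agree d X Y" "depth X \<xi> < d"
  shows "depth Y \<xi> = depth X \<xi>"
proof -
  have "depth Y \<xi> \<le> e \<longleftrightarrow> depth X \<xi> \<le> e" if "e < d" for e
  proof -
    have "(\<Sum>i\<le>e. X (front X - int i)) = (\<Sum>i\<le>e. Y (front Y - int i))"
      using assms(3) that by (intro sum.cong) (auto simp: agree_def)
    then show ?thesis using assms by (simp add: depth_le_iff)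
  qed
  note * = this
  \<comment> \<open>Only \<open>depth X\<close> is known to be below \<open>d\<close>; this puts
    \<open>depth Y\<close> there too, so that the test applies to it as well.\<close>
  have "depth Y \<xi> \<le> depth X \<xi>" using *[of "depth X \<xi>"] assms by simp
  moreover have "depth X \<xi> \<le> depth Y \<xi>" using *[of "depth Y \<xi>"] calculation assms by simp
  ultimately show ?thesis by simp
qed

text \<open>
  A letter \<open>\<xi>\<close> selects a bin of depth below \<open>\<xi>\<close>. If that bin is among the \<open>d\<close> bins on which \<open>X\<close> and \<open>Y\<close>
  agree, then both models make the same move; otherwise the ball lands in the last of these bins or
  further back, so that at most one bin of agreement is lost, and none if \<open>\<xi> = 2\<close>.
\<close>

lemma agree_step:
  assumes X: "X \<in> configs" and Y: "Y \<in> configs" and \<xi>: "\<xi> \<ge> 1" and ag: "agree d X Y"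
  shows "agree (d + 2 - \<xi>) (bin_move \<xi> X) (bin_move \<xi> Y)"
    and "d \<ge> 1 \<or> \<xi> = 1 \<Longrightarrow> depth X \<xi> = 0 \<longleftrightarrow> depth Y \<xi> = 0"
proof -
  note front = bin_move_front(2)[OF X \<xi>] bin_move_front(2)[OF Y \<xi>]
  have move: "bin_move \<xi> X k = X k + (if k = front X - int (depth X \<xi>) + 1 then 1 else 0)"
    "bin_move \<xi> Y k = Y k + (if k = front Y - int (depth Y \<xi>) + 1 then 1 else 0)" for k
    by (simp_all add: bin_move_def bin_index_depth[OF X \<xi>] bin_index_depth[OF Y \<xi>])
  have small: "agree (d + 2 - \<xi>) (bin_move \<xi> X) (bin_move \<xi> Y)" if lt: "depth X \<xi> < d"
  proof (cases "depth X \<xi> = 0")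
    case True
    \<comment> \<open>Both models create a new top bin with one ball, so agreement grows by
      one.\<close>
    have "agree (d + 1) (bin_move \<xi> X) (bin_move \<xi> Y)"
      unfolding agree_def
    proof (intro allI impI)
      fix i assume i: "i < d + 1"
      show "bin_move \<xi> X (front (bin_move \<xi> X) - int i) = bin_move \<xi> Y (front (bin_move \<xi> Y) - int i)"
      proof (cases i)
        case 0
        then show ?thesis using True agree_depth[OF X Y ag lt] configs_eq_0_iff[OF X, of "front X + 1"]
            configs_eq_0_iff[OF Y, of "front Y + 1"] unfolding front move by simp
      next
        case (Suc j)
        then show ?thesis using True agree_depth[OF X Y ag lt] ag i
          unfolding front move by (auto simp: agree_def)
      qed
    qed
    then show ?thesis by (rule agree_mono) (use \<xi> in simp)
  next
    case False
    then have "agree d (bin_move \<xi> X) (bin_move \<xi> Y)"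
      using agree_depth[OF X Y ag lt] ag unfolding agree_def front move by auto
    moreover have "\<xi> \<ge> 2" using False depth_less[OF X \<xi>] by simp
    ultimately show ?thesis by (auto elim: agree_mono)
  qed
  have eq: "depth X \<xi> < d \<longleftrightarrow> depth Y \<xi> < d"
    using agree_depth[OF X Y ag] agree_depth[OF Y X agree_sym[OF ag]] by metis
  show "agree (d + 2 - \<xi>) (bin_move \<xi> X) (bin_move \<xi> Y)"
  proof (cases "depth X \<xi> < d")
    case False
    then have ge: "d \<le> depth X \<xi>" "d \<le> depth Y \<xi>" using eq by auto
    \<comment> \<open>Both balls land at depth \<open>d - 1\<close> or further back. Letter
      \<open>1\<close> always selects the front, so it occurs here only with \<open>d = 0\<close>;
      letter \<open>2\<close> reaches depth at most \<open>1\<close>, so with \<open>d > 0\<close>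
      both models select depth \<open>1\<close>.\<close>
    consider "\<xi> = 1" | "\<xi> \<ge> 2" "d = 0" | "\<xi> = 2" "d > 0" | "\<xi> \<ge> 3" "d > 0" using \<xi> by linarith
    then show ?thesis
    proof cases
      case 1
      then have "depth X \<xi> = 0" "depth Y \<xi> = 0" using depth_less X Y by fastforce+
      moreover from this have "d = 0" using ge by simp
      ultimately show ?thesis using 1 configs_eq_0_iff[OF X, of "front X + 1"]
            configs_eq_0_iff[OF Y, of "front Y + 1"] unfolding agree_def front move by simp
    next
      case 2
      then show ?thesis by (simp add: agree_def)
    next
      case 3
      then have "depth X \<xi> = 1" "depth Y \<xi> = 1" "d = 1"
        using depth_less[OF X \<xi>] depth_less[OF Y \<xi>] ge by auto
      then show ?thesis using ag 3 unfolding agree_def front move by auto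
    next
      case 4
      then have "agree (d - 1) (bin_move \<xi> X) (bin_move \<xi> Y)"
        using ag ge unfolding agree_def front move by auto
      then show ?thesis by (rule agree_mono) (use 4 in auto)
    qed
  qed (rule small)
  show "depth X \<xi> = 0 \<longleftrightarrow> depth Y \<xi> = 0" if "d \<ge> 1 \<or> \<xi> = 1"
  proof (cases "\<xi> = 1")
    case True
    then have "depth X \<xi> = 0" "depth Y \<xi> = 0" using depth_less X Y by fastforce+
    then show ?thesis by simp
  next
    case False
    then show ?thesis using that eq agree_depth[OF X Y ag] by (cases "depth X \<xi> < d") auto
  qed
qed

section \<open>Ballot words and the cycle lemma\<close>

lemma height_Nil [simp]: "height [] = 0"
  and height_Cons [simp]: "height (x # \<alpha>) = (x - 1) + height \<alpha>"
  and height_append [simp]: "height (\<alpha> @ \<beta>) = height \<alpha> + height \<beta>"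
  by (simp_all add: height_def)

text \<open>
  All partial sums of \<open>2 - \<alpha>\<^sub>i\<close>, taken in the order in which the letters act, are positive; the partial
  sum bounds from below the number of bins at the front that no longer depend on the initial state.
\<close>

definition ballot :: "nat list \<Rightarrow> bool" where
  "ballot \<beta> \<longleftrightarrow> (\<forall>m<length \<beta>. height (drop m \<beta>) < length (drop m \<beta>))"

lemma ballot_Cons: "ballot (x # \<beta>) \<longleftrightarrow> height (x # \<beta>) < length (x # \<beta>) \<and> ballot \<beta>"
  unfolding ballot_def by (auto simp: All_less_Suc2 simp del: height_Cons)

lemma ballot_agree:
  "ballot \<beta> \<Longrightarrow> 0 \<notin> set \<beta> \<Longrightarrow> X \<in> configs \<Longrightarrow> Y \<in> configs
    \<Longrightarrow> agree (length \<beta> - height \<beta>) (act \<beta> X) (act \<beta> Y)"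
proof (induction \<beta>)
  case Nil
  then show ?case by (simp add: agree_def)
next
  case (Cons x \<beta>)
  then have "agree (length \<beta> - height \<beta>) (act \<beta> X) (act \<beta> Y)" by (simp add: ballot_Cons)
  then have "agree (length \<beta> - height \<beta> + 2 - x) (act (x # \<beta>) X) (act (x # \<beta>) Y)"
    unfolding act_Cons using Cons.prems by (intro agree_step(1) act_configs) auto
  \<comment> \<open>Ensures that \<open>length \<beta> - height \<beta>\<close> is not truncated, so
    that one letter changes it by \<open>2 - x\<close>.\<close>
  moreover have "height \<beta> \<le> length \<beta>"
    using Cons.prems by (cases \<beta>) (auto simp: ballot_Cons)
  ultimately show ?case using Cons.prems by (auto elim!: agree_mono)
qed

lemma front_step_iff:
  "X \<in> configs \<Longrightarrow> 0 \<notin> set \<alpha> \<Longrightarrow> \<alpha> \<noteq> [] \<Longrightarrow>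
    front (act \<alpha> X) = front (act (tl \<alpha>) X) + 1 \<longleftrightarrow> depth (act (tl \<alpha>) X) (hd \<alpha>) = 0"
  by (cases \<alpha>) (auto simp: bin_move_front act_configs)

text \<open>Before the last letter acts, the front bin is already independent of the initial
  configuration, unless the word is the single letter \<open>1\<close>, which always moves the
  front.\<close>

lemma ballot_front_step:
  assumes "ballot \<beta>" "0 \<notin> set \<beta>" "\<beta> \<noteq> []" "X \<in> configs" "Y \<in> configs"
  shows "front (act \<beta> X) = front (act (tl \<beta>) X) + 1 \<longleftrightarrow> front (act \<beta> Y) = front (act (tl \<beta>) Y) + 1"
proof (cases \<beta>)
  case (Cons x \<gamma>)
  have "length \<gamma> - height \<gamma> \<ge> 1 \<or> x = 1"
    using assms Cons by (cases \<gamma>) (auto simp: ballot_Cons)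
  moreover have "act \<gamma> X \<in> configs" "act \<gamma> Y \<in> configs" "x \<ge> 1"
    using assms Cons by (auto intro: act_configs)
  moreover have "agree (length \<gamma> - height \<gamma>) (act \<gamma> X) (act \<gamma> Y)"
    by (rule ballot_agree) (use assms Cons in \<open>auto simp: ballot_Cons\<close>)
  ultimately have "depth (act \<gamma> X) x = 0 \<longleftrightarrow> depth (act \<gamma> Y) x = 0"
    by (rule agree_step(2)[rotated -1])
  then show ?thesis using assms Cons by (simp add: front_step_iff bin_move_front act_configs)
qed (use assms in simp)

text \<open>Cycle lemma: take the shortest prefix whose height is below its length. Shorter prefixes
  have height at least their length, so removing one of them leaves a suffix with height below
  length; the prefix one letter shorter gives the bound on \<open>m\<close>.\<close>

lemma ex_ballot_prefix:
  assumes "height \<alpha> < length \<alpha>"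
  obtains m where "1 \<le> m" "m \<le> length \<alpha>" "ballot (take m \<alpha>)" "m \<le> Suc (height (take m \<alpha>))"
proof -
  define m where "m = (LEAST m. height (take m \<alpha>) < m)"
  have m: "height (take m \<alpha>) < m" unfolding m_def
    by (rule LeastI[of "\<lambda>m. height (take m \<alpha>) < m" "length \<alpha>"]) (use assms in simp)
  have le: "m \<le> length \<alpha>" unfolding m_def by (rule Least_le) (use assms in simp)
  have before: "k \<le> height (take k \<alpha>)" if "k < m" for k
    using not_less_Least[of k "\<lambda>m. height (take m \<alpha>) < m"] that by (auto simp: m_def)
  have split: "height (take m \<alpha>) = height (take k \<alpha>) + height (drop k (take m \<alpha>))" if "k \<le> m" for k
    using that by (metis append_take_drop_id height_append min_absorb1 take_take)
  have "ballot (take m \<alpha>)"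
    unfolding ballot_def
  proof (intro allI impI)
    fix k assume "k < length (take m \<alpha>)"
    then have "k < m" "length (drop k (take m \<alpha>)) = m - k" using le by auto
    then show "height (drop k (take m \<alpha>)) < length (drop k (take m \<alpha>))"
      using before[of k] split[of k] m by linarith
  qed
  moreover have "m \<le> Suc (height (take m \<alpha>))"
    using before[of "m - 1"] split[of "m - 1"] m by linarith
  ultimately show ?thesis using m le by (intro that[of m]) auto
qed

section \<open>Good words, minimal good words and their prefixes\<close>

lemma good_wordsD:
  assumes "\<alpha> \<in> good_words" shows "\<alpha> \<noteq> []" "0 \<notin> set \<alpha>"
    "X \<in> configs \<Longrightarrow> front (act \<alpha> X) = front (act (tl \<alpha>) X) + 1"
  using assms by (auto simp: good_words_def selection_word_def)

text \<open>The motion after a ballot word is the same for all configurations, so one instance in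
  which the front moves, reached through any past \<open>\<gamma>\<close>, settles them all.\<close>

lemma ballot_good:
  assumes "ballot \<beta>" "\<beta> \<noteq> []" "0 \<notin> set (\<beta> @ \<gamma>)" "X \<in> configs"
    and "front (act (\<beta> @ \<gamma>) X) = front (act (tl (\<beta> @ \<gamma>)) X) + 1"
  shows "\<beta> \<in> good_words"
proof -
  have "front (act \<beta> (act \<gamma> X)) = front (act (tl \<beta>) (act \<gamma> X)) + 1"
    using assms tl_append2[of \<beta> \<gamma>] by (simp add: act_append)
  then have "front (act \<beta> Y) = front (act (tl \<beta>) Y) + 1" if "Y \<in> configs" for Y
    using ballot_front_step[of \<beta> "act \<gamma> X" Y] assms that by (auto simp: act_configs)
  then show ?thesis using assms by (auto simp: good_words_def selection_word_def Suc_le_eq intro: gr0I)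
qed

text \<open>Substituting \<open>m = length \<alpha> - i + 1\<close> turns the indices of the
  right-to-left notation into lengths of list prefixes.\<close>

lemma min_good_words_iff:
  "\<alpha> \<in> min_good_words \<longleftrightarrow> \<alpha> \<in> good_words \<and> (\<forall>m. 1 \<le> m \<and> m < length \<alpha> \<longrightarrow> take m \<alpha> \<notin> good_words)"
proof -
  have "(\<forall>i\<in>{2..length \<alpha>}. take (length \<alpha> - i + 1) \<alpha> \<notin> good_words)
      \<longleftrightarrow> (\<forall>m. 1 \<le> m \<and> m < length \<alpha> \<longrightarrow> take m \<alpha> \<notin> good_words)"
  proof (intro iffI allI impI ballI)
    fix m assume *: "\<forall>i\<in>{2..length \<alpha>}. take (length \<alpha> - i + 1) \<alpha> \<notin> good_words" and "1 \<le> m \<and> m < length \<alpha>"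
    then have "length \<alpha> - m + 1 \<in> {2..length \<alpha>}" "length \<alpha> - (length \<alpha> - m + 1) + 1 = m" by auto
    then show "take m \<alpha> \<notin> good_words" using * by metis
  qed auto
  then show ?thesis by (auto simp: min_good_words_def)
qed

lemma ex_min_good_prefix:
  assumes "take m \<alpha> \<in> good_words"
  obtains k where "k \<le> m" "take k \<alpha> \<in> min_good_words"
proof -
  define k where "k = (LEAST k. take k \<alpha> \<in> good_words)"
  have "take k \<alpha> \<in> good_words" unfolding k_def by (rule LeastI[of _ m]) (fact assms)
  moreover have "k \<le> m" unfolding k_def by (rule Least_le) (fact assms)
  moreover have "take j \<alpha> \<notin> good_words" if "j < k" for j
    using not_less_Least[of j "\<lambda>k. take k \<alpha> \<in> good_words"] that by (auto simp: k_def)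
  ultimately show ?thesis by (intro that[of k]) (auto simp: min_good_words_iff)
qed

text \<open>By minimality no proper prefix of \<open>\<alpha>\<close> is good. This makes the events
  of ending with different minimal good words disjoint.\<close>

lemma min_good_words_prefix_free:
  assumes "\<alpha> \<in> min_good_words" "take k \<alpha> \<in> min_good_words"
  shows "take k \<alpha> = \<alpha>"
  using assms good_wordsD(1)[of "take k \<alpha>"] by (cases "k < length \<alpha>") (auto simp: min_good_words_iff)

text \<open>A longer word has a ballot prefix of length at most its own height plus one; that prefix
  is then proper, and it inherits goodness.\<close>

lemma min_good_words_length: "\<alpha> \<in> min_good_words \<Longrightarrow> length \<alpha> \<le> Suc (height \<alpha>)"
proof (rule ccontr)
  assume \<alpha>: "\<alpha> \<in> min_good_words" and *: "\<not> length \<alpha> \<le> Suc (height \<alpha>)"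
  from * have "height \<alpha> < length \<alpha>" by simp
  then obtain m where m: "1 \<le> m" "m \<le> length \<alpha>" "ballot (take m \<alpha>)" "m \<le> Suc (height (take m \<alpha>))"
    by (rule ex_ballot_prefix)
  have "m < length \<alpha>" using m * by (cases "m = length \<alpha>") auto
  have good: "\<alpha> \<in> good_words" using \<alpha> by (simp add: min_good_words_iff)
  \<comment> \<open>A concrete configuration on which the good word moves the front: one ball in
    every bin up to \<open>0\<close>.\<close>
  define X :: "int \<Rightarrow> enat" where "X = (\<lambda>k. if k > 0 then 0 else 1)"
  have "X \<in> configs" by (auto simp: configs_def X_def)
  then have "take m \<alpha> \<in> good_words"
    using ballot_good[of "take m \<alpha>" "drop m \<alpha>" X] m good_wordsD[OF good] by auto
  then show False using \<alpha> m \<open>m < length \<alpha>\<close> by (auto simp: min_good_words_iff)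
qed

text \<open>A ballot prefix among the latest \<open>l\<close> letters decides the motion, so it must
  be good if the front moves.\<close>

lemma front_step_min_good_prefix:
  assumes "X \<in> configs" "0 \<notin> set \<alpha>" "height (take l \<alpha>) < l" "l \<le> length \<alpha>"
    and "front (act \<alpha> X) = front (act (tl \<alpha>) X) + 1"
  shows "\<exists>m\<le>l. take m \<alpha> \<in> min_good_words"
proof -
  obtain m where m: "1 \<le> m" "m \<le> l" "ballot (take m \<alpha>)"
  proof -
    have "height (take l \<alpha>) < length (take l \<alpha>)" using assms by simp
    then obtain m where "1 \<le> m" "m \<le> length (take l \<alpha>)" "ballot (take m (take l \<alpha>))"
      by (rule ex_ballot_prefix)
    then show ?thesis using assms by (intro that[of m]) (auto simp: min_absorb1)
  qed
  have "take m \<alpha> \<in> good_words"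
    using ballot_good[of "take m \<alpha>" "drop m \<alpha>" X] m assms by (cases "\<alpha> = []") auto
  then obtain k where "k \<le> m" "take k \<alpha> \<in> min_good_words" by (rule ex_min_good_prefix)
  then show ?thesis using m by (intro exI[of _ k]) auto
qed

text \<open>The older letters only change the configuration to which the good word is
  applied.\<close>

lemma good_prefix_front_step:
  assumes "X \<in> configs" "0 \<notin> set \<alpha>" "take m \<alpha> \<in> good_words"
  shows "front (act \<alpha> X) = front (act (tl \<alpha>) X) + 1"
proof -
  have "act (drop m \<alpha>) X \<in> configs" using assms act_configs[of X "drop m \<alpha>"] by (meson in_set_dropD)
  then have "front (act (take m \<alpha>) (act (drop m \<alpha>) X)) = front (act (tl (take m \<alpha>)) (act (drop m \<alpha>) X)) + 1"
    by (rule good_wordsD(3)[OF assms(3)])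
  moreover have "tl (take m \<alpha>) @ drop m \<alpha> = tl \<alpha>"
    using good_wordsD(1)[OF assms(3)] by (metis append_take_drop_id tl_append2)
  ultimately show ?thesis by (metis act_append append_take_drop_id)
qed

section \<open>Longest paths and levels\<close>

abbreviation be_awalk where "be_awalk \<omega> \<equiv> pre_digraph.awalk (barak_erdos_graph \<omega>)"
abbreviation be_verts where "be_verts \<omega> \<equiv> pre_digraph.awalk_verts (barak_erdos_graph \<omega>)"

lemma be_awalk_Nil [simp]: "be_awalk \<omega> u [] v \<longleftrightarrow> u = v"
  by (simp add: pre_digraph.awalk_def pre_digraph.cas.simps barak_erdos_graph_def)

lemma be_awalk_Cons [simp]:
  "be_awalk \<omega> u (e # \<pi>) v \<longleftrightarrow> fst e = u \<and> u < snd e \<and> \<omega> e \<and> be_awalk \<omega> (snd e) \<pi> v"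
  by (cases e) (auto simp: pre_digraph.awalk_def pre_digraph.cas.simps barak_erdos_graph_def)

lemma be_verts_simps [simp]:
  "be_verts \<omega> u [] = [u]" "be_verts \<omega> u (e # \<pi>) = fst e # be_verts \<omega> (snd e) \<pi>"
  by (simp_all add: pre_digraph.awalk_verts.simps barak_erdos_graph_def)

lemma be_awalk_verts_distinct:
  "be_awalk \<omega> u \<pi> v \<Longrightarrow> distinct (be_verts \<omega> u \<pi>) \<and> (\<forall>w\<in>set (be_verts \<omega> u \<pi>). u \<le> w)"
  by (induction \<pi> arbitrary: u) force+

text \<open>Arcs lead from smaller to larger vertices, so a walk never revisits a vertex.\<close>

lemma be_apath_iff: "pre_digraph.apath (barak_erdos_graph \<omega>) u \<pi> v \<longleftrightarrow> be_awalk \<omega> u \<pi> v"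
  using be_awalk_verts_distinct by (auto simp: pre_digraph.apath_def)

lemma be_awalk_snoc:
  "be_awalk \<omega> u \<pi> v \<Longrightarrow> v < w \<Longrightarrow> \<omega> (v, w) \<Longrightarrow> be_awalk \<omega> u (\<pi> @ [(v, w)]) w"
  by (induction \<pi> arbitrary: u) auto

context
  fixes \<omega> :: "int \<times> int \<Rightarrow> bool" and lev :: "int \<Rightarrow> nat" and n :: nat
  assumes lev_less: "\<And>i j. 1 \<le> i \<Longrightarrow> i < j \<Longrightarrow> j \<le> int n \<Longrightarrow> \<omega> (i, j) \<Longrightarrow> lev i < lev j"
    and lev_pred: "\<And>j. 1 \<le> j \<Longrightarrow> j \<le> int n \<Longrightarrow> lev j \<noteq> 0 \<Longrightarrow> \<exists>i\<ge>1. i < j \<and> \<omega> (i, j) \<and> lev j = Suc (lev i)"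
begin

lemma be_awalk_length_le:
  "be_awalk \<omega> u \<pi> v \<Longrightarrow> 1 \<le> u \<Longrightarrow> v \<le> int n \<Longrightarrow> u \<le> v \<and> length \<pi> + lev u \<le> lev v"
proof (induction \<pi> arbitrary: u)
  case (Cons e \<pi>)
  obtain w where e: "e = (u, w)" "u < w" "\<omega> (u, w)" "be_awalk \<omega> w \<pi> v"
    using Cons.prems by (cases e) auto
  then have "w \<le> v \<and> length \<pi> + lev w \<le> lev v" using Cons by auto
  moreover from this have "lev u < lev w" using e Cons.prems by (intro lev_less) auto
  ultimately show ?case using e by auto
qed simp

lemma ex_be_awalk:
  "1 \<le> v \<Longrightarrow> v \<le> int n \<Longrightarrow> \<exists>u \<pi>. 1 \<le> u \<and> u \<le> v \<and> be_awalk \<omega> u \<pi> v \<and> length \<pi> = lev v"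
proof (induction "lev v" arbitrary: v)
  case 0
  then show ?case by (intro exI[of _ v] exI[of _ "[]"]) auto
next
  case (Suc l)
  from lev_pred[OF Suc.prems] Suc.hyps(2)
  obtain i where i: "1 \<le> i" "i < v" "\<omega> (i, v)" "lev v = Suc (lev i)" by auto
  with Suc.hyps Suc.prems obtain u \<pi> where u: "1 \<le> u" "u \<le> i" "be_awalk \<omega> u \<pi> i" "length \<pi> = lev i"
    by (metis dual_order.trans nat.inject order_less_imp_le)
  from be_awalk_snoc[OF u(3) i(2,3)] u i show ?case
    by (intro exI[of _ u] exI[of _ "\<pi> @ [(i, v)]"]) auto
qed

text \<open>Every arc raises the level, so a walk has at most as many arcs as the level of its end;
  conversely a positive level is traced down to \<open>0\<close> one arc at a time.\<close>

lemma longest_path_eq_Max_level: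
  assumes "n > 0"
  shows "longest_path \<omega> n = Max (lev ` {1..int n})"
proof -
  let ?S = "{length \<pi> |u \<pi> v. u \<in> {1..int n} \<and> v \<in> {1..int n} \<and> be_awalk \<omega> u \<pi> v}"
  have le: "y \<le> Max (lev ` {1..int n})" if yS: "y \<in> ?S" for y
  proof -
    obtain u \<pi> v where y: "y = length \<pi>" "u \<in> {1..int n}" "v \<in> {1..int n}" "be_awalk \<omega> u \<pi> v"
      using yS by blast
    then have "y \<le> lev v" using be_awalk_length_le[of u \<pi> v] by auto
    also have "\<dots> \<le> Max (lev ` {1..int n})" using y by (intro Max_ge) auto
    finally show ?thesis .
  qed
  have "Max (lev ` {1..int n}) \<in> lev ` {1..int n}" using assms by (intro Max_in) auto
  then obtain v where v: "v \<in> {1..int n}" "Max (lev ` {1..int n}) = lev v" by auto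
  then obtain u \<pi> where "1 \<le> u" "u \<le> v" "be_awalk \<omega> u \<pi> v" "length \<pi> = lev v"
    using ex_be_awalk[of v] v by auto
  then have "Max (lev ` {1..int n}) \<in> ?S"
    using v by (intro CollectI exI[of _ u] exI[of _ \<pi>] exI[of _ v]) auto
  moreover have "finite ?S" by (rule finite_subset[of _ "{..Max (lev ` {1..int n})}"]) (use le in auto)
  ultimately show ?thesis
    unfolding longest_path_def be_apath_iff using le by (intro Max_eqI) auto
qed

end

section \<open>The infinite bin model of a list of levels\<close>

text \<open>
  In a list of levels the vertex \<open>i + 1\<close> has index \<open>i\<close>. The vertices \<open>0, -1, -2, \<dots>\<close> are appended to the
  order as fictitious vertices of the bins \<open>\<le> 0\<close>: finding an edge from one of them first means that a vertex
  has no predecessor in \<open>{1, 2, \<dots>}\<close>, hence level \<open>0\<close> and bin \<open>1\<close>.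
\<close>

definition vertex_bin :: "nat list \<Rightarrow> int \<Rightarrow> nat" where
  "vertex_bin ls j = (if j \<ge> 1 then Suc (ls ! (nat j - 1)) else 0)"

definition vertex_order :: "nat list \<Rightarrow> nat \<Rightarrow> int" where
  "vertex_order ls k = (if k < length ls
     then int (sort_key (\<lambda>i. - int (ls ! i)) [0..<length ls] ! k) + 1
     else int (length ls) - int k)"

lemma vertex_order_sorted_index:
  fixes ls :: "nat list"
  defines "os \<equiv> sort_key (\<lambda>i. - int (ls ! i)) [0..<length ls]"
  shows "distinct os" "set os = {..<length ls}" "length os = length ls"
    "k \<le> k' \<Longrightarrow> k' < length ls \<Longrightarrow> ls ! (os ! k') \<le> ls ! (os ! k)"
proof -
  show "distinct os" "set os = {..<length ls}" "length os = length ls"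
    by (auto simp: os_def)
  assume *: "k \<le> k'" "k' < length ls"
  have "sorted (map (\<lambda>i. - int (ls ! i)) os)" unfolding os_def by simp
  from sorted_nth_mono[OF this, of k k'] * show "ls ! (os ! k') \<le> ls ! (os ! k)"
    by (simp add: os_def)
qed

lemma vertex_order_cases:
  obtains (pos) i where "k < length ls" "i < length ls" "vertex_order ls k = int i + 1"
      "i = sort_key (\<lambda>i. - int (ls ! i)) [0..<length ls] ! k" "vertex_bin ls (vertex_order ls k) = Suc (ls ! i)"
  | (nonpos) "length ls \<le> k" "vertex_order ls k = int (length ls) - int k"
      "vertex_bin ls (vertex_order ls k) = 0"
proof (cases "k < length ls")
  case True
  let ?i = "sort_key (\<lambda>i. - int (ls ! i)) [0..<length ls] ! k"
  have "?i \<in> set (sort_key (\<lambda>i. - int (ls ! i)) [0..<length ls])"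
    by (rule nth_mem) (use True in simp)
  then have "?i < length ls" by simp
  then show ?thesis using True by (intro pos[of ?i]) (simp_all add: vertex_order_def vertex_bin_def nat_add_distrib)
qed (auto simp: vertex_order_def vertex_bin_def intro: nonpos)

lemma vertex_order_le: "vertex_order ls k \<le> int (length ls)"
  by (cases rule: vertex_order_cases[of k ls]) auto

text \<open>Needed for the inspected edges to be distinct, hence independent.\<close>

lemma inj_vertex_order: "inj (vertex_order ls)"
proof (rule injI)
  fix k k' assume eq: "vertex_order ls k = vertex_order ls k'"
  show "k = k'"
  proof (cases rule: vertex_order_cases[of k ls])
    case (pos i)
    note k = pos
    show ?thesis
    proof (cases rule: vertex_order_cases[of k' ls])
      case (pos j)
      then have "i = j" using k eq by simp
      then show ?thesis using k pos vertex_order_sorted_index(1,3)[of ls] by (metis nth_eq_iff_index_eq)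
    next
      case nonpos
      then show ?thesis using k eq by linarith
    qed
  next
    case nonpos
    note k = nonpos
    show ?thesis
    proof (cases rule: vertex_order_cases[of k' ls])
      case (pos j)
      then show ?thesis using k eq by linarith
    next
      case nonpos
      then show ?thesis using k eq by linarith
    qed
  qed
qed

lemma vertex_order_surj:
  assumes "1 \<le> j" "j \<le> int (length ls)"
  obtains k where "k < length ls" "vertex_order ls k = j"
proof -
  let ?os = "sort_key (\<lambda>i. - int (ls ! i)) [0..<length ls]"
  have "nat j - 1 \<in> set ?os" using assms by auto
  then obtain k where "k < length ls" "?os ! k = nat j - 1"
    unfolding in_set_conv_nth by auto
  then show ?thesis using assms by (intro that[of k]) (auto simp: vertex_order_def)
qed

lemma vertex_bin_antimono:
  assumes "k \<le> k'" shows "vertex_bin ls (vertex_order ls k') \<le> vertex_bin ls (vertex_order ls k)"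
proof (cases rule: vertex_order_cases[of k' ls])
  case (pos i)
  note k' = pos
  show ?thesis
  proof (cases rule: vertex_order_cases[of k ls])
    case (pos j)
    then show ?thesis using k' vertex_order_sorted_index(4)[OF assms, of ls] by simp
  qed (use k' assms in simp)
qed simp

text \<open>Level \<open>l\<close> occupies bin \<open>l + 1\<close>. Bin \<open>0\<close> is
  infinite, so every letter exceeding the number of vertices selects it and creates a vertex of
  level \<open>0\<close>.\<close>

definition level_config :: "nat list \<Rightarrow> int \<Rightarrow> enat" where
  "level_config ls k = (if k \<le> 0 then \<infinity> else enat (count_list ls (nat k - 1)))"

lemma level_config_Nil: "level_config [] \<in> configs" "front (level_config []) = 0"
  using front_eqI[of "level_config []" 0] by (auto simp: level_config_def zero_enat_def)

lemma level_config_snoc: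
  "level_config (ls @ [v]) = (\<lambda>k. level_config ls k + (if k = int v + 1 then 1 else 0))"
  by (rule ext) (auto simp: level_config_def one_enat_def)

lemma level_config_tail_sum:
  "(\<Sum>j\<in>{j. j > int v \<and> level_config ls j \<noteq> 0}. level_config ls j) = enat (card {i. i < length ls \<and> ls ! i \<ge> v})"
proof -
  let ?S = "{l \<in> set ls. l \<ge> v}"
  have "{j. j > int v \<and> level_config ls j \<noteq> 0} = (\<lambda>l. int l + 1) ` ?S"
  proof (intro equalityI subsetI)
    fix j assume "j \<in> {j. j > int v \<and> level_config ls j \<noteq> 0}"
    then have "j > int v" "count_list ls (nat j - 1) \<noteq> 0"
      by (auto simp: level_config_def zero_enat_def split: if_splits)
    then show "j \<in> (\<lambda>l. int l + 1) ` ?S"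
      by (intro image_eqI[of _ _ "nat j - 1"]) (auto simp: count_list_0_iff)
  next
    fix j assume "j \<in> (\<lambda>l. int l + 1) ` ?S"
    then show "j \<in> {j. j > int v \<and> level_config ls j \<noteq> 0}"
      by (auto simp: level_config_def zero_enat_def count_list_0_iff nat_add_distrib)
  qed
  moreover have "inj_on (\<lambda>l. int l + 1) ?S" by (auto simp: inj_on_def)
  ultimately have "(\<Sum>j\<in>{j. j > int v \<and> level_config ls j \<noteq> 0}. level_config ls j)
      = (\<Sum>l\<in>?S. level_config ls (int l + 1))" by (simp add: sum.reindex)
  also have "\<dots> = (\<Sum>l\<in>?S. of_nat (count_list (filter (\<lambda>l. l \<ge> v) ls) l))"
  proof (rule sum.cong[OF refl])
    fix l assume "l \<in> ?S"
    then have "v \<le> l" by simp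
    then have "count_list (filter (\<lambda>l. l \<ge> v) ls) l = count_list ls l" by (induction ls) auto
    then show "level_config ls (int l + 1) = of_nat (count_list (filter (\<lambda>l. l \<ge> v) ls) l)"
      by (simp add: level_config_def of_nat_eq_enat nat_add_distrib)
  qed
  also have "\<dots> = of_nat (\<Sum>l\<in>?S. count_list (filter (\<lambda>l. l \<ge> v) ls) l)" by simp
  also have "(\<Sum>l\<in>?S. count_list (filter (\<lambda>l. l \<ge> v) ls) l) = length (filter (\<lambda>l. l \<ge> v) ls)"
    by (rule sum_count_set) auto
  also have "\<dots> = card {i. i < length ls \<and> ls ! i \<ge> v}" by (rule length_filter_conv_card)
  finally show ?thesis by (simp add: of_nat_eq_enat)
qed

text \<open>Vertices in strictly higher bins all precede position \<open>k\<close>, so there are at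
  most \<open>k\<close> of them; the first \<open>k + 1\<close> vertices all lie in the bin of
  position \<open>k\<close> or higher. If that bin is \<open>0\<close>, its infinite content
  replaces the second count.\<close>

lemma bin_index_level_config:
  assumes conf: "level_config ls \<in> configs"
  shows "bin_index (level_config ls) (Suc k) = int (vertex_bin ls (vertex_order ls k))"
proof (rule bin_index_eqI[OF conf])
  let ?v = "vertex_bin ls (vertex_order ls k)"
  have "{i. i < length ls \<and> ls ! i \<ge> ?v} \<subseteq> (\<lambda>k'. nat (vertex_order ls k' - 1)) ` {..<k}"
  proof
    fix i assume i: "i \<in> {i. i < length ls \<and> ls ! i \<ge> ?v}"
    then obtain k' where k': "k' < length ls" "vertex_order ls k' = int i + 1"
      using vertex_order_surj[of "int i + 1" ls] by auto
    then have "vertex_bin ls (vertex_order ls k') > ?v"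
      using i by (simp add: vertex_bin_def nat_add_distrib)
    then have "k' < k" using vertex_bin_antimono[of k k' ls] by (meson leD not_le_imp_less)
    then show "i \<in> (\<lambda>k'. nat (vertex_order ls k' - 1)) ` {..<k}" using k' by force
  qed
  then have "card {i. i < length ls \<and> ls ! i \<ge> ?v} \<le> k"
    using surj_card_le[of "{..<k}"] by fastforce
  then show "(\<Sum>j\<in>{j. j > int ?v \<and> level_config ls j \<noteq> 0}. level_config ls j) < enat (Suc k)"
    by (simp add: level_config_tail_sum)
  show "enat (Suc k) \<le> (\<Sum>j\<in>{j. j > int ?v - 1 \<and> level_config ls j \<noteq> 0}. level_config ls j)"
  proof (cases ?v)
    case 0
    have "finite {j. j > int ?v - 1 \<and> level_config ls j \<noteq> 0}"
      by (rule finite_subset[of _ "{int ?v - 1..front (level_config ls)}"])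
        (auto dest: configs_le_front[OF conf])
    then have "(\<Sum>j\<in>{0}. level_config ls j) \<le> (\<Sum>j\<in>{j. j > int ?v - 1 \<and> level_config ls j \<noteq> 0}. level_config ls j)"
      by (rule sum_mono2) (use 0 in \<open>auto simp: level_config_def\<close>)
    then show ?thesis by (simp add: level_config_def)
  next
    case (Suc u)
    have big: "1 \<le> vertex_order ls k' \<and> nat (vertex_order ls k' - 1) \<in> {i. i < length ls \<and> ls ! i \<ge> u}"
      if "k' \<le> k" for k'
      using vertex_bin_antimono[OF that, of ls] Suc
      by (cases rule: vertex_order_cases[of k' ls]) auto
    have "inj_on (\<lambda>k'. nat (vertex_order ls k' - 1)) {..k}"
    proof (rule inj_onI)
      fix x y assume "x \<in> {..k}" "y \<in> {..k}" "nat (vertex_order ls x - 1) = nat (vertex_order ls y - 1)"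
      then have "vertex_order ls x = vertex_order ls y" using big[of x] big[of y] by (simp add: eq_nat_nat_iff)
      then show "x = y" using inj_vertex_order by (simp add: inj_eq)
    qed
    then have "card {..k} \<le> card {i. i < length ls \<and> ls ! i \<ge> u}"
      by (rule card_inj_on_le) (use big in auto)
    then show ?thesis using level_config_tail_sum[where v = u and ls = ls] Suc by simp
  qed
qed

lemma front_level_config:
  assumes "level_config ls \<in> configs" "ls \<noteq> []"
  shows "front (level_config ls) = int (Max (set ls)) + 1"
proof -
  let ?m = "Max (set ls)"
  have "?m \<in> set ls" using assms by simp
  then have "level_config ls (int ?m + 1) \<noteq> 0"
    by (auto simp: level_config_def zero_enat_def count_list_0_iff nat_add_distrib)
  then have "int ?m + 1 \<le> front (level_config ls)" by (rule configs_le_front[OF assms(1)])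
  moreover have "Suc ?m \<notin> set ls" using Max_ge[of "set ls" "Suc ?m"] by (meson List.finite_set Suc_n_not_le_n)
  then have "level_config ls (int ?m + 2) = 0"
    by (auto simp: level_config_def zero_enat_def count_list_0_iff nat_add_distrib)
  then have "front (level_config ls) < int ?m + 2" by (simp add: configs_eq_0_iff[OF assms(1)])
  ultimately show ?thesis by simp
qed

text \<open>Reconstructs the levels from the letters alone: letter \<open>x\<close> names position
  \<open>x - 1\<close> as first predecessor, and the bin of that vertex, one above its level, is the
  new level.\<close>

fun levels :: "nat list \<Rightarrow> nat list" where
  "levels [] = []"
| "levels (x # h) = levels h @ [vertex_bin (levels h) (vertex_order (levels h) (x - 1))]"

lemma length_levels [simp]: "length (levels h) = length h"
  by (induction h) auto

lemma level_config_levels: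
  "0 \<notin> set h \<Longrightarrow> level_config (levels h) = act h (level_config []) \<and> level_config (levels h) \<in> configs"
proof (induction h)
  case (Cons x h)
  then have "level_config (levels h) \<in> configs" "x = Suc (x - 1)" by auto
  then have "bin_index (level_config (levels h)) x
      = int (vertex_bin (levels h) (vertex_order (levels h) (x - 1)))"
    using bin_index_level_config by metis
  then have "level_config (levels (x # h)) = bin_move x (level_config (levels h))"
    unfolding levels.simps level_config_snoc bin_move_def by (simp only:)
  then show ?case using Cons bin_move_front(1)[of "level_config (levels h)" x] by auto
qed (use level_config_Nil in simp)

section \<open>The letters read off the graph are independent and geometric\<close>

definition letter_pmf :: "real \<Rightarrow> nat pmf" where
  "letter_pmf p = map_pmf Suc (geometric_pmf p)"

primrec words_pmf :: "real \<Rightarrow> nat \<Rightarrow> nat list pmf" where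
  "words_pmf p 0 = return_pmf []"
| "words_pmf p (Suc n) = map_pmf (\<lambda>(x, h). x # h) (pair_pmf (letter_pmf p) (words_pmf p n))"

lemma pmf_letter: "0 < p \<Longrightarrow> p \<le> 1 \<Longrightarrow> pmf (letter_pmf p) x = (if x = 0 then 0 else p * (1 - p) ^ (x - 1))"
proof (cases x)
  case 0
  then show ?thesis by (auto simp: letter_pmf_def pmf_eq_0_set_pmf)
next
  case (Suc k)
  moreover assume "0 < p" "p \<le> 1"
  ultimately show ?thesis by (simp add: letter_pmf_def pmf_map_inj')
qed

lemma pmf_words_Cons: "pmf (words_pmf p (Suc n)) (x # h) = pmf (letter_pmf p) x * pmf (words_pmf p n) h"
proof -
  have "inj (\<lambda>(x, h). x # h :: nat list)" by (auto simp: inj_def)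
  from pmf_map_inj'[OF this, of "pair_pmf (letter_pmf p) (words_pmf p n)" "(x, h)"]
  show ?thesis by (simp add: pmf_pair)
qed

lemma set_words_pmf: "h \<in> set_pmf (words_pmf p n) \<Longrightarrow> length h = n \<and> 0 \<notin> set h"
  by (induction n arbitrary: h) (auto simp: letter_pmf_def)

lemma pmf_words: "length h = n \<Longrightarrow> pmf (words_pmf p n) h = (\<Prod>x\<leftarrow>h. pmf (letter_pmf p) x)"
  by (induction n arbitrary: h) (auto simp: length_Suc_conv pmf_words_Cons simp del: words_pmf.simps(2))

text \<open>Stationarity: the law of the \<open>l\<close> latest letters does not depend on how many
  came before.\<close>

lemma take_words_pmf: "map_pmf (take l) (words_pmf p (l + n)) = words_pmf p l"
proof (induction l)
  case (Suc l)
  have "map_pmf (take (Suc l)) (words_pmf p (Suc l + n))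
    = map_pmf (\<lambda>(x, h). x # h) (map_pmf (map_prod id (take l)) (pair_pmf (letter_pmf p) (words_pmf p (l + n))))"
    by (simp add: pmf.map_comp o_def case_prod_unfold)
  also have "map_pmf (map_prod id (take l)) (pair_pmf (letter_pmf p) (words_pmf p (l + n)))
    = pair_pmf (letter_pmf p) (words_pmf p l)"
    using map_pair[of id "take l" "letter_pmf p" "words_pmf p (l + n)"] Suc
    by (simp add: map_prod_def pmf.map_id)
  finally show ?case by simp
qed (simp add: map_pmf_const)

lemma measure_words_pmf_prod:
  "measure_pmf.prob (words_pmf p n) {h. length h = n \<and> (\<forall>i<n. rev h ! i \<in> F i)}
    = (\<Prod>i<n. measure_pmf.prob (letter_pmf p) (F i))"
proof (induction n)
  case (Suc n)
  have "(\<lambda>(x, h). x # h) -` {h. length h = Suc n \<and> (\<forall>i<Suc n. rev h ! i \<in> F i)}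
      = F n \<times> {h. length h = n \<and> (\<forall>i<n. rev h ! i \<in> F i)}"
    by (auto simp: nth_append less_Suc_eq)
  then show ?case using Suc by (simp add: measure_pmf_prob_product mult.commute)
qed simp

lemma pmf_has_sum: "(pmf R has_sum measure_pmf.prob R A) A"
proof -
  have "Infinite_Sum.abs_summable_on (pmf R) A" unfolding abs_summable_equivalent by (rule pmf_abs_summable)
  then have "(pmf R has_sum infsum (pmf R) A) A"
    using abs_summable_summable by (auto simp: has_sum_infsum)
  also have "infsum (pmf R) A = measure_pmf.prob R A"
    by (simp add: measure_pmf_conv_infsetsum infsetsum_infsum pmf_abs_summable)
  finally show ?thesis .
qed

text \<open>The support carries all the mass of \<open>R\<close>, hence also that of
  \<open>D\<close>, so point masses on the support suffice.\<close>

lemma measure_eq_measure_pmf: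
  fixes R :: "'a :: countable pmf"
  assumes D: "prob_space D" "sets D = UNIV" and eq: "\<And>x. x \<in> set_pmf R \<Longrightarrow> measure D {x} = pmf R x"
  shows "D = measure_pmf R"
proof -
  interpret prob_space D by fact
  have sing: "emeasure D {x} = emeasure (measure_pmf R) {x}" if "x \<in> set_pmf R" for x
    using eq[OF that] by (simp add: emeasure_eq_measure emeasure_pmf_single)
  have "emeasure D (set_pmf R) = (\<integral>\<^sup>+x. emeasure D {x} \<partial>count_space (set_pmf R))"
    by (rule emeasure_countable_singleton) (auto simp: D)
  also have "\<dots> = (\<integral>\<^sup>+x. emeasure (measure_pmf R) {x} \<partial>count_space (set_pmf R))"
    by (rule nn_integral_cong) (simp add: sing)
  also have "\<dots> = emeasure (measure_pmf R) (set_pmf R)"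
    by (rule emeasure_countable_singleton[symmetric]) auto
  also have "\<dots> = 1" by (simp add: measure_pmf.emeasure_eq_measure measure_pmf.prob_eq_1 AE_measure_pmf)
  finally have "AE x in D. x \<in> set_pmf R"
    by (subst AE_in_set_eq_1) (auto simp: D emeasure_eq_measure)
  then show ?thesis
    by (intro measure_eqI_countable_AE[of _ _ "set_pmf R"]) (auto simp: D sing AE_measure_pmf)
qed

text \<open>
  Vertex \<open>n + 1\<close> inspects the smaller vertices in an order \<open>\<sigma> h\<close> that depends only on the letters
  \<open>h\<close> of the earlier vertices, latest first; its letter is the number of inspections until the first
  edge. The value \<open>0\<close> marks the null event that no edge is found.
\<close>

definition next_letter :: "(nat list \<Rightarrow> nat \<Rightarrow> int) \<Rightarrow> (int \<times> int \<Rightarrow> bool) \<Rightarrow> nat list \<Rightarrow> nat" where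
  "next_letter \<sigma> \<omega> h = (if \<exists>k. \<omega> (\<sigma> h k, int (length h) + 1)
     then Suc (LEAST k. \<omega> (\<sigma> h k, int (length h) + 1)) else 0)"

primrec history :: "(nat list \<Rightarrow> nat \<Rightarrow> int) \<Rightarrow> (int \<times> int \<Rightarrow> bool) \<Rightarrow> nat \<Rightarrow> nat list" where
  "history \<sigma> \<omega> 0 = []"
| "history \<sigma> \<omega> (Suc n) = next_letter \<sigma> \<omega> (history \<sigma> \<omega> n) # history \<sigma> \<omega> n"

lemma length_history [simp]: "length (history \<sigma> \<omega> n) = n"
  by (induction n) auto

text \<open>Expresses the event through the first \<open>k\<close> inspections, hence through
  finitely many edges.\<close>

lemma next_letter_eq_iff:
  "k \<noteq> 0 \<Longrightarrow> next_letter \<sigma> \<omega> h = k \<longleftrightarrow> (\<forall>j<k. \<omega> (\<sigma> h j, int (length h) + 1) = (j = k - 1))"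
proof
  assume k: "k \<noteq> 0" and *: "next_letter \<sigma> \<omega> h = k"
  let ?P = "\<lambda>j. \<omega> (\<sigma> h j, int (length h) + 1)"
  have ex: "\<exists>j. ?P j" and least: "(LEAST j. ?P j) = k - 1"
    using k * by (auto simp: next_letter_def split: if_splits)
  from LeastI_ex[OF ex] least have "?P (k - 1)" by simp
  moreover have "\<not> ?P j" if "j < k - 1" for j using not_less_Least[of j ?P] that least by simp
  ultimately show "\<forall>j<k. ?P j = (j = k - 1)" using k by (metis Suc_pred' less_SucE neq0_conv)
next
  assume k: "k \<noteq> 0" and *: "\<forall>j<k. \<omega> (\<sigma> h j, int (length h) + 1) = (j = k - 1)"
  let ?P = "\<lambda>j. \<omega> (\<sigma> h j, int (length h) + 1)"
  have "?P (k - 1)" using * k by simp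
  moreover have "(LEAST j. ?P j) = k - 1"
  proof (rule Least_equality)
    fix j assume "?P j"
    show "k - 1 \<le> j"
    proof (rule ccontr)
      assume "\<not> k - 1 \<le> j"
      then show False using * \<open>?P j\<close> by auto
    qed
  qed fact
  ultimately show "next_letter \<sigma> \<omega> h = k" using k by (auto simp: next_letter_def)
qed

text \<open>The edges revealed while \<open>h\<close> is produced; \<open>found\<close> collects
  those that were present.\<close>

primrec inspected :: "(nat list \<Rightarrow> nat \<Rightarrow> int) \<Rightarrow> nat list \<Rightarrow> (int \<times> int) set" where
  "inspected \<sigma> [] = {}"
| "inspected \<sigma> (k # h) = (\<lambda>j. (\<sigma> h j, int (length h) + 1)) ` {..<k} \<union> inspected \<sigma> h"

primrec found :: "(nat list \<Rightarrow> nat \<Rightarrow> int) \<Rightarrow> nat list \<Rightarrow> (int \<times> int) set" where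
  "found \<sigma> [] = {}"
| "found \<sigma> (k # h) = insert (\<sigma> h (k - 1), int (length h) + 1) (found \<sigma> h)"

lemma finite_inspected: "finite (inspected \<sigma> h)"
  by (induction h) auto

lemma inspected_snd_le: "e \<in> inspected \<sigma> h \<Longrightarrow> snd e \<le> int (length h)"
  and found_snd_le: "e \<in> found \<sigma> h \<Longrightarrow> snd e \<le> int (length h)"
  by (induction h) force+

section \<open>The law of the letters read off the random edges\<close>

lemma space_barak_erdos: "space (barak_erdos_space p) = PiE {(i, j). i < j} (\<lambda>_. UNIV)"
  by (simp add: barak_erdos_space_def space_PiM)

lemma prob_space_barak_erdos: "prob_space (barak_erdos_space p)"
  unfolding barak_erdos_space_def by (intro prob_space_PiM prob_space_measure_pmf)

lemma measurable_edge [measurable]: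
  "i < j \<Longrightarrow> (\<lambda>\<omega>. \<omega> (i, j)) \<in> barak_erdos_space p \<rightarrow>\<^sub>M count_space UNIV"
  unfolding barak_erdos_space_def
  using measurable_component_singleton[of "(i, j)" "{(i, j). i < j}" "\<lambda>_. measure_pmf (bernoulli_pmf p)"]
  by (simp cong: measurable_cong_sets)

lemma measure_edges:
  assumes J: "J \<subseteq> {(i, j). i < j}" "finite J"
  shows "measure (barak_erdos_space p) {\<omega> \<in> space (barak_erdos_space p). \<forall>e\<in>J. \<omega> e = v e}
    = (\<Prod>e\<in>J. pmf (bernoulli_pmf p) (v e))"
proof -
  interpret product_prob_space "\<lambda>_. measure_pmf (bernoulli_pmf p)" "{(i :: int, j). i < j}"
    by unfold_locales
  have "{\<omega> \<in> space (barak_erdos_space p). \<forall>e\<in>J. \<omega> e = v e}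
      = prod_emb {(i, j). i < j} (\<lambda>_. measure_pmf (bernoulli_pmf p)) J (PiE J (\<lambda>e. {v e}))"
    unfolding space_barak_erdos by (auto simp: prod_emb_def PiE_iff extensional_def)
  then have "measure (barak_erdos_space p) {\<omega> \<in> space (barak_erdos_space p). \<forall>e\<in>J. \<omega> e = v e}
      = (\<Prod>e\<in>J. measure_pmf.prob (bernoulli_pmf p) {v e})"
    unfolding barak_erdos_space_def using measure_PiM_emb[OF J, of "\<lambda>e. {v e}"] by simp
  then show ?thesis by (simp add: measure_pmf_single)
qed

text \<open>Injectivity prevents a vertex from inspecting an edge twice, and the upper bound makes
  every inspected pair a forward edge.\<close>

locale inspection =
  fixes \<sigma> :: "nat list \<Rightarrow> nat \<Rightarrow> int" and p :: real
  assumes inj: "\<And>h. inj (\<sigma> h)" and le: "\<And>h k. \<sigma> h k \<le> int (length h)" and p: "0 < p" "p \<le> 1"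
begin

abbreviation "M \<equiv> barak_erdos_space p"

sublocale prob_space M by (rule prob_space_barak_erdos)

lemma history_eq_iff:
  "0 \<notin> set h \<Longrightarrow> history \<sigma> \<omega> (length h) = h \<longleftrightarrow> (\<forall>e\<in>inspected \<sigma> h. \<omega> e = (e \<in> found \<sigma> h))"
proof (induction h)
  case (Cons k h)
  \<comment> \<open>Edges found earlier end at earlier vertices, so none of them coincides with a
    new one.\<close>
  have new: "(\<sigma> h j, int (length h) + 1) \<in> found \<sigma> (k # h) \<longleftrightarrow> j = k - 1" for j
    using found_snd_le[of "(\<sigma> h j, int (length h) + 1)" \<sigma> h] inj[of h] by (auto simp: inj_eq)
  have old: "e \<in> found \<sigma> (k # h) \<longleftrightarrow> e \<in> found \<sigma> h" if "e \<in> inspected \<sigma> h" for e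
    using inspected_snd_le[OF that] by auto
  have "history \<sigma> \<omega> (length (k # h)) = k # h \<longleftrightarrow> history \<sigma> \<omega> (length h) = h \<and> next_letter \<sigma> \<omega> h = k"
    by auto
  also have "\<dots> \<longleftrightarrow> (\<forall>e\<in>inspected \<sigma> (k # h). \<omega> e = (e \<in> found \<sigma> (k # h)))"
    using Cons new old by (simp add: next_letter_eq_iff ball_Un del: found.simps) blast
  finally show ?case .
qed simp

text \<open>Letter \<open>k\<close> costs \<open>k - 1\<close> absent edges and one present edge,
  which is its geometric weight; different vertices inspect disjoint sets of edges.\<close>

lemma prod_inspected:
  "0 \<notin> set h \<Longrightarrow> (\<Prod>e\<in>inspected \<sigma> h. pmf (bernoulli_pmf p) (e \<in> found \<sigma> h)) = (\<Prod>x\<leftarrow>h. pmf (letter_pmf p) x)"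
proof (induction h)
  case (Cons k h)
  let ?e = "\<lambda>j. (\<sigma> h j, int (length h) + 1)"
  obtain m where k: "k = Suc m" using Cons.prems by (cases k) auto
  have new: "?e j \<in> found \<sigma> (k # h) \<longleftrightarrow> j = k - 1" for j
    using found_snd_le[of "(\<sigma> h j, int (length h) + 1)" \<sigma> h] inj[of h] by (auto simp: inj_eq)
  have old: "e \<in> found \<sigma> (k # h) \<longleftrightarrow> e \<in> found \<sigma> h" if "e \<in> inspected \<sigma> h" for e
    using inspected_snd_le[OF that] by auto
  have disj: "?e ` {..<k} \<inter> inspected \<sigma> h = {}" using inspected_snd_le by fastforce
  have inje: "inj_on ?e {..<k}" using inj[of h] by (auto simp: inj_on_def)
  have "(\<Prod>e\<in>inspected \<sigma> (k # h). pmf (bernoulli_pmf p) (e \<in> found \<sigma> (k # h)))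
      = (\<Prod>e\<in>?e ` {..<k}. pmf (bernoulli_pmf p) (e \<in> found \<sigma> (k # h)))
        * (\<Prod>e\<in>inspected \<sigma> h. pmf (bernoulli_pmf p) (e \<in> found \<sigma> (k # h)))"
    unfolding inspected.simps by (rule prod.union_disjoint) (use disj finite_inspected in auto)
  also have "(\<Prod>e\<in>inspected \<sigma> h. pmf (bernoulli_pmf p) (e \<in> found \<sigma> (k # h)))
      = (\<Prod>x\<leftarrow>h. pmf (letter_pmf p) x)"
    using Cons old by (simp del: found.simps cong: prod.cong)
  also have "(\<Prod>e\<in>?e ` {..<k}. pmf (bernoulli_pmf p) (e \<in> found \<sigma> (k # h)))
      = (\<Prod>j<k. pmf (bernoulli_pmf p) (j = k - 1))"
    unfolding prod.reindex[OF inje] by (simp add: new del: found.simps)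
  also have "\<dots> = (\<Prod>j<m. pmf (bernoulli_pmf p) False) * pmf (bernoulli_pmf p) True"
    unfolding k by (simp cong: prod.cong_simp)
  also have "\<dots> = pmf (letter_pmf p) k" using p k by (simp add: pmf_letter)
  finally show ?case by simp
qed simp

text \<open>The new letter depends on the whole history, but that takes countably many values, and
  for a fixed history only forward edges are read.\<close>

lemma measurable_history [measurable]: "(\<lambda>\<omega>. history \<sigma> \<omega> n) \<in> M \<rightarrow>\<^sub>M count_space UNIV"
proof (induction n)
  case (Suc n)
  have "(\<lambda>\<omega>. next_letter \<sigma> \<omega> h # h) \<in> M \<rightarrow>\<^sub>M count_space UNIV" for h
  proof -
    have "\<sigma> h k < int (length h) + 1" for k using le[of h k] by simp
    note [measurable] = measurable_edge[OF this]
    show ?thesis unfolding next_letter_def by measurable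
  qed
  from measurable_compose_countable[OF this Suc] show ?case by simp
qed simp

lemma distr_history: "distr M (count_space UNIV) (\<lambda>\<omega>. history \<sigma> \<omega> n) = measure_pmf (words_pmf p n)"
proof (rule measure_eq_measure_pmf)
  show "prob_space (distr M (count_space UNIV) (\<lambda>\<omega>. history \<sigma> \<omega> n))" by (rule prob_space_distr) simp
  fix h assume "h \<in> set_pmf (words_pmf p n)"
  then have h: "length h = n" "0 \<notin> set h" using set_words_pmf by auto
  have sub: "inspected \<sigma> h' \<subseteq> {(i, j). i < j}" for h'
    by (induction h') (use le in \<open>auto simp: le_less_trans\<close>)
  have "measure (distr M (count_space UNIV) (\<lambda>\<omega>. history \<sigma> \<omega> n)) {h}
      = prob {\<omega> \<in> space M. history \<sigma> \<omega> (length h) = h}"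
    by (subst measure_distr) (auto simp: h vimage_def Int_def conj_commute)
  also have "\<dots> = prob {\<omega> \<in> space M. \<forall>e\<in>inspected \<sigma> h. \<omega> e = (e \<in> found \<sigma> h)}"
    using history_eq_iff[OF h(2)] by simp
  also have "\<dots> = (\<Prod>x\<leftarrow>h. pmf (letter_pmf p) x)"
    using measure_edges[OF sub finite_inspected] prod_inspected[OF h(2)] by simp
  finally show "measure (distr M (count_space UNIV) (\<lambda>\<omega>. history \<sigma> \<omega> n)) {h} = pmf (words_pmf p n) h"
    using h by (simp add: pmf_words)
qed simp

lemma prob_history: "prob {\<omega> \<in> space M. history \<sigma> \<omega> n \<in> A} = measure_pmf.prob (words_pmf p n) A"
proof -
  have "measure (distr M (count_space UNIV) (\<lambda>\<omega>. history \<sigma> \<omega> n)) A = prob {\<omega> \<in> space M. history \<sigma> \<omega> n \<in> A}"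
    by (subst measure_distr) (auto simp: vimage_def Int_def conj_commute)
  then show ?thesis by (simp add: distr_history)
qed

lemma AE_history_pos: "AE \<omega> in M. \<forall>n. 0 \<notin> set (history \<sigma> \<omega> n)"
proof -
  have "AE \<omega> in M. 0 \<notin> set (history \<sigma> \<omega> n)" for n
  proof -
    have "AE h in distr M (count_space UNIV) (\<lambda>\<omega>. history \<sigma> \<omega> n). 0 \<notin> set h"
      unfolding distr_history using set_words_pmf by (auto simp: AE_measure_pmf_iff)
    then show ?thesis by (subst (asm) AE_distr_iff) auto
  qed
  then show ?thesis by (simp add: AE_all_countable)
qed

section \<open>Letters as independent random variables\<close>

definition letter :: "nat \<Rightarrow> (int \<times> int \<Rightarrow> bool) \<Rightarrow> nat" where
  "letter i \<omega> = next_letter \<sigma> \<omega> (history \<sigma> \<omega> i)"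

lemma history_eq_map_letter: "history \<sigma> \<omega> n = map (\<lambda>i. letter i \<omega>) (rev [0..<n])"
  by (induction n) (auto simp: letter_def)

lemma measurable_letter [measurable]: "letter i \<in> M \<rightarrow>\<^sub>M count_space UNIV"
proof -
  have "(\<lambda>\<omega>. hd (history \<sigma> \<omega> (Suc i))) \<in> M \<rightarrow>\<^sub>M count_space UNIV" by measurable
  then show ?thesis by (simp add: letter_def[abs_def])
qed

lemma prob_letters:
  "prob {\<omega> \<in> space M. \<forall>i<n. letter i \<omega> \<in> F i} = (\<Prod>i<n. measure_pmf.prob (letter_pmf p) (F i))"
proof -
  have "{\<omega> \<in> space M. \<forall>i<n. letter i \<omega> \<in> F i}
      = {\<omega> \<in> space M. history \<sigma> \<omega> n \<in> {h. length h = n \<and> (\<forall>i<n. rev h ! i \<in> F i)}}"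
    by (auto simp: history_eq_map_letter rev_map)
  then show ?thesis unfolding measure_words_pmf_prod[symmetric] prob_history[symmetric] by (rule arg_cong)
qed

lemma prob_letters_finite:
  assumes "finite J"
  shows "prob {\<omega> \<in> space M. \<forall>i\<in>J. letter i \<omega> \<in> F i} = (\<Prod>i\<in>J. measure_pmf.prob (letter_pmf p) (F i))"
proof -
  obtain n where n: "J \<subseteq> {..<n}" using assms finite_nat_iff_bounded by blast
  let ?F = "\<lambda>i. if i \<in> J then F i else UNIV"
  have "{\<omega> \<in> space M. \<forall>i\<in>J. letter i \<omega> \<in> F i} = {\<omega> \<in> space M. \<forall>i<n. letter i \<omega> \<in> ?F i}"
    using n by auto
  then have "prob {\<omega> \<in> space M. \<forall>i\<in>J. letter i \<omega> \<in> F i} = (\<Prod>i<n. measure_pmf.prob (letter_pmf p) (?F i))"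
    using prob_letters[of n ?F] by (rule trans[OF arg_cong])
  also have "\<dots> = (\<Prod>i\<in>J. measure_pmf.prob (letter_pmf p) (F i))"
    using n by (intro prod.mono_neutral_cong_right) auto
  finally show ?thesis .
qed

text \<open>Each letter is defined through all earlier ones; independence comes from the product
  form of the joint law.\<close>

lemma indep_letters: "indep_vars (\<lambda>_. count_space UNIV) letter UNIV"
  unfolding indep_vars_def2
proof (intro conjI ballI indep_setsI)
  fix A :: "nat \<Rightarrow> (int \<times> int \<Rightarrow> bool) set" and J
  assume J: "J \<noteq> {}" "J \<subseteq> UNIV" "finite J"
    and A: "\<forall>j\<in>J. A j \<in> {letter j -` B \<inter> space M |B. B \<in> sets (count_space UNIV)}"
  then obtain F where F: "\<And>j. j \<in> J \<Longrightarrow> A j = letter j -` F j \<inter> space M" by (auto simp: subset_eq) metis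
  have "(\<Inter>j\<in>J. A j) = {\<omega> \<in> space M. \<forall>i\<in>J. letter i \<omega> \<in> F i}" using F J by auto
  moreover have "prob (A j) = measure_pmf.prob (letter_pmf p) (F j)" if "j \<in> J" for j
  proof -
    have "A j = {\<omega> \<in> space M. \<forall>i\<in>{j}. letter i \<omega> \<in> F i}" using F[OF that] by auto
    then show ?thesis using prob_letters_finite[of "{j}" F] by simp
  qed
  ultimately show "prob (\<Inter>j\<in>J. A j) = (\<Prod>j\<in>J. prob (A j))"
    using prob_letters_finite[OF J(3), of F] by simp
qed auto

lemma prob_window:
  "prob {\<omega> \<in> space M. take l (history \<sigma> \<omega> (i + l)) \<in> A} = measure_pmf.prob (words_pmf p l) A"
proof -
  have "prob {\<omega> \<in> space M. take l (history \<sigma> \<omega> (i + l)) \<in> A}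
      = measure_pmf.prob (words_pmf p (i + l)) (take l -` A)"
    using prob_history[of "i + l" "take l -` A"] by simp
  also have "\<dots> = measure_pmf.prob (map_pmf (take l) (words_pmf p (l + i))) A"
    by (simp add: add.commute)
  finally show ?thesis by (simp add: take_words_pmf)
qed

end

section \<open>A strong law of large numbers for windows of independent letters\<close>

lemma measurable_map_components:
  "set js \<subseteq> K \<Longrightarrow> (\<lambda>x. map x js) \<in> PiM K (\<lambda>_. count_space (UNIV :: nat set)) \<rightarrow>\<^sub>M count_space UNIV"
proof (induction js)
  case (Cons j js)
  have "(\<lambda>x. x j # l) \<in> PiM K (\<lambda>_. count_space (UNIV :: nat set)) \<rightarrow>\<^sub>M count_space UNIV" for l :: "nat list"
  proof -
    have "(\<lambda>x. x j) \<in> PiM K (\<lambda>_. count_space (UNIV :: nat set)) \<rightarrow>\<^sub>M count_space UNIV"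
      by (rule measurable_component_singleton) (use Cons.prems in auto)
    then show ?thesis by simp
  qed
  from measurable_compose_countable[OF this Cons.IH] Cons.prems show ?case by simp
qed simp

definition window :: "(nat \<Rightarrow> 'a \<Rightarrow> nat) \<Rightarrow> nat \<Rightarrow> nat \<Rightarrow> 'a \<Rightarrow> nat list" where
  "window X l i \<omega> = map (\<lambda>j. X j \<omega>) (rev [i..<i + l])"

lemma (in prob_space) indep_windows:
  assumes indep: "indep_vars (\<lambda>_. count_space UNIV) X UNIV"
  shows "indep_vars (\<lambda>_. borel) (\<lambda>i \<omega>. of_bool (window X l i \<omega> \<in> A) :: real) {i. i < n \<and> i mod l = r}"
proof -
  let ?I = "{i. i < n \<and> i mod l = r}"
  have disj: "disjoint_family_on (\<lambda>i. {i..<i + l}) ?I"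
    unfolding disjoint_family_on_def
  proof (intro ballI impI)
    fix i j assume ij: "i \<in> ?I" "j \<in> ?I" "i \<noteq> j"
    \<comment> \<open>Distinct starts in one residue class differ by a positive multiple of
      \<open>l\<close>.\<close>
    have "i + l \<le> j" if "i < j" "i mod l = j mod l" for i j :: nat
    proof -
      have "l dvd j - i" using that by (metis less_imp_le_nat mod_eq_dvd_iff_nat)
      then have "l \<le> j - i" using that by (intro dvd_imp_le) auto
      then show ?thesis using that by simp
    qed
    then have "i + l \<le> j \<or> j + l \<le> i" using ij by (metis (mono_tags, lifting) linorder_neqE_nat mem_Collect_eq)
    then show "{i..<i + l} \<inter> {j..<j + l} = {}" by auto
  qed
  let ?Y = "\<lambda>i x. of_bool (map x (rev [i..<i + l]) \<in> A) :: real"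
  have "indep_vars (\<lambda>j. PiM {j..<j + l} (\<lambda>_. count_space UNIV)) (\<lambda>j \<omega>. restrict (\<lambda>i. X i \<omega>) {j..<j + l}) ?I"
    by (rule indep_vars_restrict[OF indep _ disj]) auto
  then have "indep_vars (\<lambda>_. borel) (\<lambda>i \<omega>. ?Y i (restrict (\<lambda>i. X i \<omega>) {i..<i + l})) ?I"
  proof (rule indep_vars_compose2)
    fix i
    have "(\<lambda>h. of_bool (h \<in> A) :: real) \<in> count_space UNIV \<rightarrow>\<^sub>M borel" by simp
    moreover have "(\<lambda>x :: nat \<Rightarrow> nat. map x (rev [i..<i + l])) \<in> PiM {i..<i + l} (\<lambda>_. count_space UNIV) \<rightarrow>\<^sub>M count_space UNIV"
      by (rule measurable_map_components) auto
    ultimately show "?Y i \<in> PiM {i..<i + l} (\<lambda>_. count_space UNIV) \<rightarrow>\<^sub>M borel"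
      by (rule measurable_compose[rotated])
  qed
  moreover have "?Y i (restrict (\<lambda>i. X i \<omega>) {i..<i + l}) = of_bool (window X l i \<omega> \<in> A)" for i \<omega>
    unfolding window_def by (intro arg_cong[of _ _ "\<lambda>h. of_bool (h \<in> A)"] map_cong) auto
  ultimately show ?thesis by (simp only:)
qed

lemma (in prob_space) random_variable_window:
  assumes indep: "indep_vars (\<lambda>_. count_space UNIV) X UNIV"
  shows "(\<lambda>\<omega>. of_bool (window X l i \<omega> \<in> A) :: real) \<in> borel_measurable M"
proof -
  have "i \<in> {j. j < Suc i \<and> j mod l = i mod l}" by simp
  with indep_windows[OF indep, of l A "Suc i" "i mod l"] show ?thesis
    unfolding indep_vars_def by blast
qed

text \<open>Windows that start in one residue class modulo their length do not overlap.\<close>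

lemma (in prob_space) window_deviation:
  fixes c \<delta> :: real
  assumes indep: "indep_vars (\<lambda>_. count_space UNIV) X UNIV"
    and l: "l > 0" and \<delta>: "\<delta> > 0" and n: "n > 0"
    and c: "\<And>i. expectation (\<lambda>\<omega>. of_bool (window X l i \<omega> \<in> A)) = c"
  shows "prob {\<omega> \<in> space M. \<bar>(\<Sum>i<n. of_bool (window X l i \<omega> \<in> A)) - n * c\<bar> \<ge> \<delta> * n}
    \<le> 2 * l * exp (- 2 * \<delta>\<^sup>2 / l\<^sup>2) ^ n"
proof -
  let ?Y = "\<lambda>i \<omega>. of_bool (window X l i \<omega> \<in> A) :: real"
  let ?I = "\<lambda>r. {i. i < n \<and> i mod l = r}"
  \<comment> \<open>A total deviation of \<open>\<delta> * n\<close> forces one of the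
    \<open>l\<close> residue classes to deviate by at least \<open>\<delta> * n / l\<close>.\<close>
  let ?B = "\<lambda>r. {\<omega> \<in> space M. \<bar>(\<Sum>i\<in>?I r. ?Y i \<omega>) - (\<Sum>i\<in>?I r. c)\<bar> \<ge> \<delta> * n / l}"
  note [measurable] = random_variable_window[OF indep]
  have split: "(\<Sum>i<n. f i) = (\<Sum>r<l. \<Sum>i\<in>?I r. f i)" for f :: "nat \<Rightarrow> real"
  proof -
    have "(\<lambda>i. i mod l) ` {..<n} \<subseteq> {..<l}" using l by auto
    from sum.group[OF _ _ this, of f] show ?thesis by simp
  qed
  have B: "prob (?B r) \<le> 2 * exp (- 2 * \<delta>\<^sup>2 / l\<^sup>2) ^ n" for r
  proof (cases "?I r = {}")
    case True
    have "\<delta> * n / l > 0" using \<delta> n l by simp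
    then show ?thesis unfolding True by simp
  next
    case False
    interpret Hoeffding_ineq M "?I r" ?Y "\<lambda>_. 0" "\<lambda>_. 1" "\<Sum>i\<in>?I r. expectation (?Y i)"
      by unfold_locales (auto simp: indep_windows[OF indep])
    have card: "card (?I r) > 0" "card (?I r) \<le> n"
      using False card_mono[of "{..<n}" "?I r"] by (auto simp: card_gt_0_iff)
    have "prob (?B r) \<le> 2 * exp (- 2 * (\<delta> * n / l)\<^sup>2 / card (?I r))"
      using Hoeffding_ineq_abs_ge[of "\<delta> * n / l"] \<delta> l card by (simp add: c)
    \<comment> \<open>A class has at most \<open>n\<close> windows; this crude bound keeps the
      exponent linear in \<open>n\<close>.\<close>
    also have "(\<delta> * n / l)\<^sup>2 / card (?I r) \<ge> (\<delta> * n / l)\<^sup>2 / n"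
      using card by (intro divide_left_mono) auto
    then have "2 * exp (- 2 * (\<delta> * n / l)\<^sup>2 / card (?I r)) \<le> 2 * exp (- 2 * (\<delta> * n / l)\<^sup>2 / n)"
      by simp
    also have "- 2 * (\<delta> * n / l)\<^sup>2 / n = n * (- 2 * \<delta>\<^sup>2 / l\<^sup>2)"
      using n by (simp add: power2_eq_square field_simps)
    also have "exp \<dots> = exp (- 2 * \<delta>\<^sup>2 / l\<^sup>2) ^ n" by (rule exp_of_nat_mult)
    finally show ?thesis .
  qed
  have "{\<omega> \<in> space M. \<bar>(\<Sum>i<n. ?Y i \<omega>) - n * c\<bar> \<ge> \<delta> * n} \<subseteq> (\<Union>r<l. ?B r)"
  proof
    fix \<omega> assume \<omega>: "\<omega> \<in> {\<omega> \<in> space M. \<bar>(\<Sum>i<n. ?Y i \<omega>) - n * c\<bar> \<ge> \<delta> * n}"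
    show "\<omega> \<in> (\<Union>r<l. ?B r)"
    proof (rule ccontr)
      assume "\<omega> \<notin> (\<Union>r<l. ?B r)"
      then have *: "\<bar>(\<Sum>i\<in>?I r. ?Y i \<omega>) - (\<Sum>i\<in>?I r. c)\<bar> < \<delta> * n / l" if "r < l" for r
        using \<omega> that by (auto simp: not_le)
      have "n * c = (\<Sum>i<n. c)" by simp
      then have "\<bar>(\<Sum>i<n. ?Y i \<omega>) - n * c\<bar> = \<bar>\<Sum>r<l. (\<Sum>i\<in>?I r. ?Y i \<omega>) - (\<Sum>i\<in>?I r. c)\<bar>"
        unfolding split sum_subtractf by simp
      also have "\<dots> \<le> (\<Sum>r<l. \<bar>(\<Sum>i\<in>?I r. ?Y i \<omega>) - (\<Sum>i\<in>?I r. c)\<bar>)" by (rule sum_abs)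
      also have "\<dots> < (\<Sum>r<l. \<delta> * n / l)" using l * by (intro sum_strict_mono) auto
      also have "\<dots> = \<delta> * n" using l by simp
      finally show False using \<omega> by simp
    qed
  qed
  then have "prob {\<omega> \<in> space M. \<bar>(\<Sum>i<n. ?Y i \<omega>) - n * c\<bar> \<ge> \<delta> * n} \<le> prob (\<Union>r<l. ?B r)"
    by (rule finite_measure_mono) measurable
  also have "\<dots> \<le> (\<Sum>r<l. prob (?B r))"
  proof (rule finite_measure_subadditive_finite)
    have "?B r \<in> events" for r by measurable
    then show "?B ` {..<l} \<subseteq> events" by blast
  qed simp
  also have "\<dots> \<le> (\<Sum>r<l. 2 * exp (- 2 * \<delta>\<^sup>2 / l\<^sup>2) ^ n)" by (rule sum_mono) (rule B)
  finally show ?thesis by (simp add: mult_ac)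
qed

text \<open>The deviation probabilities are dominated by a geometric series, so Borel-Cantelli
  applies for each tolerance.\<close>

lemma (in prob_space) window_slln:
  fixes c :: real
  assumes indep: "indep_vars (\<lambda>_. count_space UNIV) X UNIV" and l: "l > 0"
    and c: "\<And>i. expectation (\<lambda>\<omega>. of_bool (window X l i \<omega> \<in> A)) = c"
  shows "AE \<omega> in M. (\<lambda>n. (\<Sum>i<n. of_bool (window X l i \<omega> \<in> A)) / n) \<longlonglongrightarrow> c"
proof -
  note [measurable] = random_variable_window[OF indep]
  have "AE \<omega> in M. \<forall>\<^sub>F n in sequentially. \<bar>(\<Sum>i<n. of_bool (window X l i \<omega> \<in> A)) / n - c\<bar> < \<delta>"
    if \<delta>: "\<delta> > 0" for \<delta> :: real
  proof -
    let ?B = "\<lambda>n. {\<omega> \<in> space M. \<bar>(\<Sum>i<n. of_bool (window X l i \<omega> \<in> A)) - real n * c\<bar> \<ge> \<delta> * n}"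
    have "summable (\<lambda>n. 2 * l * exp (- 2 * \<delta>\<^sup>2 / l\<^sup>2) ^ n)"
      by (intro summable_mult summable_geometric) (use l \<delta> in simp)
    then have "summable (\<lambda>n. prob (?B n))"
      by (rule summable_comparison_test_ev[rotated], intro eventually_sequentiallyI[of 1])
        (use window_deviation[OF indep l \<delta> _ c] in auto)
    then have "AE \<omega> in M. \<forall>\<^sub>F n in sequentially. \<omega> \<in> space M - ?B n"
    proof (rule borel_cantelli_AE1[rotated 2])
      show "?B n \<in> events" for n by measurable
      show "emeasure M (?B n) < \<infinity>" for n by (simp add: emeasure_eq_measure)
    qed
    then show ?thesis
    proof (rule AE_mp, intro AE_I2 impI)
      fix \<omega> assume "\<forall>\<^sub>F n in sequentially. \<omega> \<in> space M - ?B n"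
      then show "\<forall>\<^sub>F n in sequentially. \<bar>(\<Sum>i<n. of_bool (window X l i \<omega> \<in> A)) / n - c\<bar> < \<delta>"
        using eventually_gt_at_top[of 0]
      proof eventually_elim
        case (elim n)
        have "(\<Sum>i<n. of_bool (window X l i \<omega> \<in> A)) / n - c = ((\<Sum>i<n. of_bool (window X l i \<omega> \<in> A)) - n * c) / n"
          using elim by (simp add: field_simps)
        then show ?case using elim by (simp add: not_le pos_divide_less_eq)
      qed
    qed
  qed
  \<comment> \<open>Countably many tolerances, so that the exceptional null sets can be
    united.\<close>
  then have "AE \<omega> in M. \<forall>k. \<forall>\<^sub>F n in sequentially. \<bar>(\<Sum>i<n. of_bool (window X l i \<omega> \<in> A)) / n - c\<bar> < inverse (real (Suc k))"
    by (subst AE_all_countable) auto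
  then show ?thesis
  proof (rule AE_mp, intro AE_I2 impI tendstoI)
    fix \<omega> and e :: real
    assume *: "\<forall>k. \<forall>\<^sub>F n in sequentially. \<bar>(\<Sum>i<n. of_bool (window X l i \<omega> \<in> A)) / n - c\<bar> < inverse (real (Suc k))"
      and "e > 0"
    then obtain k where "inverse (real (Suc k)) < e" using reals_Archimedean by blast
    from *[rule_format, of k] show "\<forall>\<^sub>F n in sequentially. dist ((\<Sum>i<n. of_bool (window X l i \<omega> \<in> A)) / n) c < e"
      by eventually_elim (use \<open>inverse (real (Suc k)) < e\<close> in \<open>auto simp: dist_real_def\<close>)
  qed
qed

section \<open>Weights of minimal good words\<close>

text \<open>Enlarging \<open>V\<close> to the product of its sets of heads and tails makes the sum
  factor.\<close>

lemma sum_lists_prod_le: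
  fixes f :: "'a \<Rightarrow> real"
  assumes f: "\<And>x. f x \<ge> 0" and s: "\<And>F. finite F \<Longrightarrow> sum f F \<le> s"
  shows "finite V \<Longrightarrow> (\<And>v. v \<in> V \<Longrightarrow> length v = n) \<Longrightarrow> (\<Sum>v\<in>V. \<Prod>x\<leftarrow>v. f x) \<le> s ^ n"
proof (induction n arbitrary: V)
  case 0
  then have "V \<subseteq> {[]}" by auto
  then have "V = {} \<or> V = {[]}" by blast
  then show ?case by auto
next
  case (Suc n)
  have nonneg: "(\<Prod>x\<leftarrow>v. f x) \<ge> 0" for v by (induction v) (auto simp: f)
  have "V \<subseteq> (\<lambda>(x, h). x # h) ` (hd ` V \<times> tl ` V)"
  proof
    fix v assume "v \<in> V"
    moreover from this Suc.prems(2) obtain x h where "v = x # h" by (cases v) fastforce+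
    ultimately show "v \<in> (\<lambda>(x, h). x # h) ` (hd ` V \<times> tl ` V)"
      by (intro image_eqI[of _ _ "(x, h)"]) force+
  qed
  then have "(\<Sum>v\<in>V. \<Prod>x\<leftarrow>v. f x) \<le> (\<Sum>v\<in>(\<lambda>(x, h). x # h) ` (hd ` V \<times> tl ` V). \<Prod>x\<leftarrow>v. f x)"
    by (intro sum_mono2) (use Suc.prems nonneg in auto)
  also have "\<dots> = (\<Sum>(x, h)\<in>hd ` V \<times> tl ` V. f x * (\<Prod>x\<leftarrow>h. f x))"
    by (subst sum.reindex) (auto simp: inj_on_def case_prod_unfold)
  also have "\<dots> = sum f (hd ` V) * (\<Sum>h\<in>tl ` V. \<Prod>x\<leftarrow>h. f x)"
    by (simp add: sum.cartesian_product[symmetric] sum_product)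
  also have "\<dots> \<le> s * s ^ n"
  proof (rule mult_mono)
    show "(\<Sum>h\<in>tl ` V. \<Prod>x\<leftarrow>h. f x) \<le> s ^ n" by (rule Suc.IH) (use Suc.prems in auto)
    show "0 \<le> s" using s[of "{}"] by simp
    show "0 \<le> (\<Sum>h\<in>tl ` V. \<Prod>x\<leftarrow>h. f x)" by (rule sum_nonneg) (rule nonneg)
  qed (use s Suc.prems in auto)
  finally show ?case by simp
qed

definition half_weight :: "real \<Rightarrow> nat \<Rightarrow> real" where
  "half_weight \<theta> x = (if x = 0 then 0 else \<theta> / 2 ^ x)"

lemma half_weight_nonneg: "\<theta> \<ge> 0 \<Longrightarrow> half_weight \<theta> x \<ge> 0"
  by (simp add: half_weight_def)

lemma sum_half_weight_le:
  assumes "\<theta> \<ge> 0" "finite F" shows "sum (half_weight \<theta>) F \<le> \<theta>"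
proof -
  have zero: "half_weight \<theta> 0 = 0" by (simp add: half_weight_def)
  have "(\<lambda>k. half_weight \<theta> (Suc k)) sums (\<theta> * 1)"
    using sums_mult[OF power_half_series, of \<theta>] by (simp add: half_weight_def power_one_over field_simps)
  then have *: "half_weight \<theta> sums \<theta>"
    using sums_Suc_imp[of "half_weight \<theta>" \<theta>, OF zero] by simp
  have "sum (half_weight \<theta>) F \<le> suminf (half_weight \<theta>)"
    by (rule sum_le_suminf) (use * assms half_weight_nonneg in \<open>auto simp: sums_iff\<close>)
  then show ?thesis using * by (simp add: sums_iff)
qed

lemma prod_half_weight:
  "0 \<notin> set \<alpha> \<Longrightarrow> (\<Prod>x\<leftarrow>\<alpha>. half_weight \<theta> x) = \<theta> ^ length \<alpha> / 2 ^ (height \<alpha> + length \<alpha>)"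
proof (induction \<alpha>)
  case (Cons x \<alpha>)
  then obtain m where "x = Suc m" by (cases x) auto
  then show ?case using Cons by (simp add: half_weight_def power_add)
qed simp

text \<open>
  For words with \<open>|\<alpha>| \<le> H(\<alpha>) + 1\<close> one may multiply by \<open>(1/(2r))\<^bsup>H(\<alpha>) + 1 - |\<alpha>|\<^esup> \<ge> 1\<close>, which turns the
  weight into a product over the letters; the choice \<open>1/(2r)\<close> minimises the sum of its factors.
\<close>

lemma weight_le_half_weight:
  fixes r :: real
  assumes r: "0 < r" "2 * r \<le> 1" and \<alpha>: "0 \<notin> set \<alpha>" "length \<alpha> \<le> Suc (height \<alpha>)"
  shows "(1 + r) ^ length \<alpha> * r ^ height \<alpha> \<le> (\<Prod>x\<leftarrow>\<alpha>. half_weight (4 * r * (1 + r)) x) / (2 * r)"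
proof -
  let ?l = "length \<alpha>" and ?h = "height \<alpha>"
  have "(1 + r) ^ ?l * r ^ ?h = (1 + r) ^ ?l / 2 ^ ?h * (2 * r) ^ Suc ?h / (2 * r)"
    using r by (simp add: power_mult_distrib)
  also have "\<dots> \<le> (1 + r) ^ ?l / 2 ^ ?h * (2 * r) ^ ?l / (2 * r)"
    using r \<alpha> by (intro divide_right_mono mult_left_mono power_decreasing) auto
  also have "(1 + r) ^ ?l / 2 ^ ?h * (2 * r) ^ ?l = (4 * r * (1 + r)) ^ ?l / 2 ^ (?h + ?l)"
  proof -
    have "(4 * r * (1 + r)) ^ ?l = 2 ^ ?l * ((2 * r) ^ ?l * (1 + r) ^ ?l)"
      unfolding power_mult_distrib[symmetric] by (rule arg_cong[where f = "\<lambda>x. x ^ ?l"]) simp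
    then show ?thesis by (simp add: power_add)
  qed
  finally show ?thesis by (simp add: prod_half_weight[OF \<alpha>(1)])
qed

text \<open>For positive letters, the probability that the latest letters form
  \<open>\<alpha>\<close>.\<close>

definition word_weight :: "real \<Rightarrow> nat list \<Rightarrow> real" where
  "word_weight q \<alpha> = (1 - q) ^ length \<alpha> * q ^ height \<alpha>"

lemma prod_letter_pmf:
  "0 \<le> q \<Longrightarrow> q < 1 \<Longrightarrow> 0 \<notin> set \<alpha> \<Longrightarrow> (\<Prod>x\<leftarrow>\<alpha>. pmf (letter_pmf (1 - q)) x) = word_weight q \<alpha>"
proof (induction \<alpha>)
  case (Cons x \<alpha>)
  then obtain m where "x = Suc m" by (cases x) auto
  then show ?case using Cons by (simp add: word_weight_def pmf_letter power_add)
qed (simp add: word_weight_def)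

text \<open>For \<open>q \<ge> 0\<close> the second assumption is the bound of the theorem, stated
  as a geometric ratio below \<open>1\<close>.\<close>

locale small_q =
  fixes q :: real
  assumes q_nonneg: "0 \<le> q" and q_less: "4 * q * (1 + q) < 1"
begin

text \<open>The parameter \<open>r\<close> replaces \<open>q\<close> in upper bounds, so that \<open>q = 0\<close> needs no special treatment.\<close>

definition r :: real where "r = max q (1 / 10)"

definition \<theta> :: real where "\<theta> = 4 * r * (1 + r)"

lemma r: "0 < r" "q \<le> r" "2 * r \<le> 1" and \<theta>: "0 \<le> \<theta>" "\<theta> < 1"
proof -
  have "r > 0" "q \<le> r" by (auto simp: r_def)
  \<comment> \<open>The value at \<open>r = 1 / 10\<close> is \<open>0.44\<close>.\<close>
  moreover have "\<theta> < 1" using q_less by (auto simp: \<theta>_def r_def max_def)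
  moreover have "2 * r \<le> \<theta>" using \<open>r > 0\<close> by (simp add: \<theta>_def algebra_simps)
  ultimately show "0 < r" "q \<le> r" "2 * r \<le> 1" "0 \<le> \<theta>" "\<theta> < 1" by auto
qed

lemma q_less_1: "q < 1" using r by simp

lemma weight_mono:
  "(1 - q) ^ length \<alpha> * q ^ height \<alpha> \<le> (1 + q) ^ length \<alpha> * q ^ height \<alpha>"
  "(1 + q) ^ length \<alpha> * q ^ height \<alpha> \<le> (1 + r) ^ length \<alpha> * r ^ height \<alpha>"
  using q_nonneg r q_less_1 by (auto intro!: mult_mono power_mono)

text \<open>Serves twice: for the minimal good words and for the undecided pasts.\<close>

lemma sum_short_words_le:
  assumes V: "finite V" "\<And>v. v \<in> V \<Longrightarrow> length v = n \<and> 0 \<notin> set v \<and> length v \<le> Suc (height v)"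
  shows "(\<Sum>v\<in>V. (1 + q) ^ length v * q ^ height v) \<le> \<theta> ^ n / (2 * r)"
proof -
  have "(\<Sum>v\<in>V. (1 + q) ^ length v * q ^ height v) \<le> (\<Sum>v\<in>V. (\<Prod>x\<leftarrow>v. half_weight \<theta> x) / (2 * r))"
  proof (rule sum_mono)
    fix v assume "v \<in> V"
    then have "(1 + r) ^ length v * r ^ height v \<le> (\<Prod>x\<leftarrow>v. half_weight \<theta> x) / (2 * r)"
      unfolding \<theta>_def using r V by (intro weight_le_half_weight) auto
    then show "(1 + q) ^ length v * q ^ height v \<le> (\<Prod>x\<leftarrow>v. half_weight \<theta> x) / (2 * r)"
      using weight_mono(2)[of v] by linarith
  qed
  also have "\<dots> = (\<Sum>v\<in>V. \<Prod>x\<leftarrow>v. half_weight \<theta> x) / (2 * r)" by (simp add: sum_divide_distrib)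
  also have "\<dots> \<le> \<theta> ^ n / (2 * r)"
    using r V \<theta> by (intro divide_right_mono sum_lists_prod_le sum_half_weight_le half_weight_nonneg) auto
  finally show ?thesis .
qed

lemma min_good_words_pos: "\<alpha> \<in> min_good_words \<Longrightarrow> 0 \<notin> set \<alpha>"
  by (simp add: min_good_words_iff good_wordsD(2))

text \<open>Grouping by length bounds all finite partial sums by one geometric series. The factor
  \<open>1 + q\<close> is what absolute values leave of the expanded powers of
  \<open>1 - q\<close>.\<close>

lemma summable_min_good: "(\<lambda>\<alpha>. (1 + q) ^ length \<alpha> * q ^ height \<alpha>) summable_on min_good_words"
proof (rule nonneg_bdd_above_summable_on)
  show "bdd_above (sum (\<lambda>\<alpha>. (1 + q) ^ length \<alpha> * q ^ height \<alpha>) ` {F. F \<subseteq> min_good_words \<and> finite F})"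
  proof (rule bdd_aboveI2)
    fix F assume "F \<in> {F. F \<subseteq> min_good_words \<and> finite F}"
    then have F: "F \<subseteq> min_good_words" "finite F" by auto
    define N where "N = Suc (Max (length ` F))"
    have N: "length ` F \<subseteq> {..<N}" using F by (auto simp: N_def less_Suc_eq_le)
    have "(\<Sum>\<alpha>\<in>F. (1 + q) ^ length \<alpha> * q ^ height \<alpha>)
        = (\<Sum>n<N. \<Sum>\<alpha>\<in>{\<alpha> \<in> F. length \<alpha> = n}. (1 + q) ^ length \<alpha> * q ^ height \<alpha>)"
      by (rule sum.group[symmetric]) (use F N in auto)
    also have "\<dots> \<le> (\<Sum>n<N. \<theta> ^ n / (2 * r))"
      by (intro sum_mono sum_short_words_le)
        (use F min_good_words_pos min_good_words_length in auto)
    also have "\<dots> = (\<Sum>n<N. \<theta> ^ n) / (2 * r)" by (simp add: sum_divide_distrib)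
    also have "\<dots> \<le> (1 / (1 - \<theta>)) / (2 * r)"
    proof (rule divide_right_mono)
      have "(\<Sum>n<N. \<theta> ^ n) \<le> (\<Sum>n. \<theta> ^ n)"
        by (rule sum_le_suminf) (use \<theta> in \<open>auto intro: summable_geometric\<close>)
      then show "(\<Sum>n<N. \<theta> ^ n) \<le> 1 / (1 - \<theta>)" using \<theta> by (simp add: suminf_geometric)
    qed (use r in simp)
    finally show "(\<Sum>\<alpha>\<in>F. (1 + q) ^ length \<alpha> * q ^ height \<alpha>) \<le> (1 / (1 - \<theta>)) / (2 * r)" .
  qed
qed (use q_nonneg in auto)

definition speed :: real where "speed = (\<Sum>\<^sub>\<infinity>\<alpha>\<in>min_good_words. word_weight q \<alpha>)"

lemma word_weight_nonneg: "word_weight q \<alpha> \<ge> 0"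
  using q_nonneg q_less_1 by (simp add: word_weight_def)

lemma speed_has_sum: "(word_weight q has_sum speed) min_good_words"
  unfolding speed_def
proof (rule has_sum_infsum)
  show "word_weight q summable_on min_good_words"
    by (rule summable_on_comparison_test[OF summable_min_good])
      (use weight_mono(1) word_weight_nonneg in \<open>auto simp: word_weight_def\<close>)
qed

section \<open>Probability that a finite past decides the motion\<close>

abbreviation words :: "nat \<Rightarrow> nat list pmf" where "words l \<equiv> words_pmf (1 - q) l"

definition starts_min_good :: "nat \<Rightarrow> nat list set" where
  "starts_min_good l = {v. \<exists>m\<le>l. take m v \<in> min_good_words}"

text \<open>For words of length \<open>l\<close> the opposite condition \<open>height v < l\<close>
  yields a ballot prefix, which settles whether the front moves.\<close>

definition undecided :: "nat \<Rightarrow> nat list set" where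
  "undecided l = {v. l \<le> height v}"

lemma prob_prefix:
  assumes "0 \<notin> set \<alpha>" "length \<alpha> \<le> l"
  shows "measure_pmf.prob (words l) {v. take (length \<alpha>) v = \<alpha>} = word_weight q \<alpha>"
proof -
  have "word_weight q \<alpha> = measure_pmf.prob (words (length \<alpha>)) {\<alpha>}"
    using q_nonneg q_less_1 assms by (simp add: measure_pmf_single pmf_words prod_letter_pmf)
  also have "words (length \<alpha>) = map_pmf (take (length \<alpha>)) (words (length \<alpha> + (l - length \<alpha>)))"
    by (rule take_words_pmf[symmetric])
  also have "measure_pmf.prob \<dots> {\<alpha>} = measure_pmf.prob (words l) {v. take (length \<alpha>) v = \<alpha>}"
    using assms by (simp add: vimage_def)
  finally show ?thesis by simp
qed

text \<open>A finite set of words involves finitely many minimal good prefixes, and a union bound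
  suffices in this direction.\<close>

lemma prob_starts_min_good_le: "measure_pmf.prob (words l) (starts_min_good l) \<le> speed"
proof (rule has_sum_le_finite_sums[OF pmf_has_sum])
  fix V assume V: "finite V" "V \<subseteq> starts_min_good l"
  then have "\<forall>v\<in>V. \<exists>m\<le>l. take m v \<in> min_good_words" by (auto simp: starts_min_good_def)
  then obtain m where m: "\<And>v. v \<in> V \<Longrightarrow> m v \<le> l \<and> take (m v) v \<in> min_good_words" by metis
  let ?P = "(\<lambda>v. take (m v) v) ` V"
  have P: "?P \<subseteq> min_good_words" "finite ?P" using m V by auto
  have "sum (pmf (words l)) V = measure_pmf.prob (words l) V"
    using V by (simp add: measure_measure_pmf_finite)
  also have "\<dots> \<le> measure_pmf.prob (words l) (\<Union>\<alpha>\<in>?P. {v. take (length \<alpha>) v = \<alpha>})"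
    by (rule measure_pmf.finite_measure_mono) (auto simp: min_def)
  also have "\<dots> \<le> (\<Sum>\<alpha>\<in>?P. measure_pmf.prob (words l) {v. take (length \<alpha>) v = \<alpha>})"
    by (rule measure_pmf.finite_measure_subadditive_finite) (use P in auto)
  also have "\<dots> = (\<Sum>\<alpha>\<in>?P. word_weight q \<alpha>)"
  proof (rule sum.cong[OF refl])
    fix \<alpha> assume "\<alpha> \<in> ?P"
    then show "measure_pmf.prob (words l) {v. take (length \<alpha>) v = \<alpha>} = word_weight q \<alpha>"
      using m P by (intro prob_prefix min_good_words_pos) fastforce+
  qed
  also have "\<dots> \<le> speed"
    by (rule finite_sum_le_has_sum[OF speed_has_sum]) (use P word_weight_nonneg in auto)
  finally show "sum (pmf (words l)) V \<le> speed" .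
qed

text \<open>In this direction the events must be disjoint, which holds because the minimal good
  words are prefix-free.\<close>

lemma sum_le_prob_starts_min_good:
  assumes F: "finite F" "F \<subseteq> min_good_words" "\<And>\<alpha>. \<alpha> \<in> F \<Longrightarrow> length \<alpha> \<le> l"
  shows "sum (word_weight q) F \<le> measure_pmf.prob (words l) (starts_min_good l)"
proof -
  have "sum (word_weight q) F = (\<Sum>\<alpha>\<in>F. measure_pmf.prob (words l) {v. take (length \<alpha>) v = \<alpha>})"
    using F min_good_words_pos by (intro sum.cong) (auto simp: prob_prefix)
  also have "\<dots> = measure_pmf.prob (words l) (\<Union>\<alpha>\<in>F. {v. take (length \<alpha>) v = \<alpha>})"
  proof (rule measure_pmf.finite_measure_finite_Union[symmetric])
    have eq: "\<alpha> = \<beta>" if "\<alpha> \<in> F" "\<beta> \<in> F" "take (length \<alpha>) v = \<alpha>" "take (length \<beta>) v = \<beta>" "length \<alpha> \<le> length \<beta>"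
      for \<alpha> \<beta> v
    proof -
      have "take (length \<alpha>) \<beta> = \<alpha>" using that by (metis min_absorb1 take_take)
      then show ?thesis using min_good_words_prefix_free[of \<beta> "length \<alpha>"] that F by auto
    qed
    show "disjoint_family_on (\<lambda>\<alpha>. {v. take (length \<alpha>) v = \<alpha>}) F"
      unfolding disjoint_family_on_def
    proof (intro ballI impI)
      fix \<alpha> \<beta> assume "\<alpha> \<in> F" "\<beta> \<in> F" "\<alpha> \<noteq> \<beta>"
      then show "{v. take (length \<alpha>) v = \<alpha>} \<inter> {v. take (length \<beta>) v = \<beta>} = {}"
        using eq[of \<alpha> \<beta>] eq[of \<beta> \<alpha>] by (metis (mono_tags, lifting) disjoint_iff mem_Collect_eq nle_le)
    qed
  qed (use F in auto)
  also have "\<dots> \<le> measure_pmf.prob (words l) (starts_min_good l)"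
  proof (rule measure_pmf.finite_measure_mono)
    show "(\<Union>\<alpha>\<in>F. {v. take (length \<alpha>) v = \<alpha>}) \<subseteq> starts_min_good l"
    proof
      fix v assume "v \<in> (\<Union>\<alpha>\<in>F. {v. take (length \<alpha>) v = \<alpha>})"
      then obtain \<alpha> where "\<alpha> \<in> F" "take (length \<alpha>) v = \<alpha>" by auto
      then show "v \<in> starts_min_good l"
        unfolding starts_min_good_def using F by (intro CollectI exI[of _ "length \<alpha>"]) auto
    qed
  qed simp
  finally show ?thesis .
qed

lemma prob_starts_min_good_tendsto:
  "(\<lambda>l. measure_pmf.prob (words l) (starts_min_good l)) \<longlonglongrightarrow> speed"
proof (rule LIMSEQ_I)
  fix e :: real assume "e > 0"
  then obtain F where F: "finite F" "F \<subseteq> min_good_words" "dist (sum (word_weight q) F) speed \<le> e / 2"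
    using has_sum_finite_approximation[OF speed_has_sum, of "e / 2"] by auto
  have "norm (measure_pmf.prob (words l) (starts_min_good l) - speed) < e" if "l \<ge> Max (length ` F)" for l
  proof -
    have "length \<alpha> \<le> l" if "\<alpha> \<in> F" for \<alpha>
    proof -
      have "length \<alpha> \<le> Max (length ` F)" using that F by (intro Max_ge) auto
      then show ?thesis using \<open>l \<ge> Max (length ` F)\<close> by linarith
    qed
    then have "sum (word_weight q) F \<le> measure_pmf.prob (words l) (starts_min_good l)"
      using F by (intro sum_le_prob_starts_min_good) auto
    then show ?thesis using prob_starts_min_good_le[of l] F(3) \<open>e > 0\<close> by (auto simp: dist_real_def)
  qed
  then show "\<exists>no. \<forall>n\<ge>no. norm (measure_pmf.prob (words n) (starts_min_good n) - speed) < e" by blast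
qed

lemma prob_undecided_le: "measure_pmf.prob (words l) (undecided l) \<le> \<theta> ^ l / (2 * r)"
proof (rule has_sum_le_finite_sums[OF pmf_has_sum])
  fix V assume V: "finite V" "V \<subseteq> undecided l"
  \<comment> \<open>On the support, words have length \<open>l\<close> and positive letters, and
    \<open>l \<le> height v\<close> makes the bound for short words applicable.\<close>
  let ?W = "{v \<in> V. v \<in> set_pmf (words l)}"
  have "sum (pmf (words l)) V = sum (pmf (words l)) ?W"
    by (rule sum.mono_neutral_right) (use V in \<open>auto simp: set_pmf_iff\<close>)
  also have "\<dots> \<le> (\<Sum>v\<in>?W. (1 + q) ^ length v * q ^ height v)"
  proof (rule sum_mono)
    fix v assume "v \<in> ?W"
    then have "pmf (words l) v = word_weight q v"
      using set_words_pmf[of v "1 - q" l] q_nonneg q_less_1 by (simp add: pmf_words prod_letter_pmf)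
    then show "pmf (words l) v \<le> (1 + q) ^ length v * q ^ height v"
      using weight_mono(1)[of v] by (simp add: word_weight_def)
  qed
  also have "\<dots> \<le> \<theta> ^ l / (2 * r)"
    by (rule sum_short_words_le) (use V set_words_pmf[of _ "1 - q" l] in \<open>auto simp: undecided_def\<close>)
  finally show "sum (pmf (words l)) V \<le> \<theta> ^ l / (2 * r)" .
qed

lemma prob_undecided_tendsto: "(\<lambda>l. measure_pmf.prob (words l) (undecided l)) \<longlonglongrightarrow> 0"
proof (rule tendsto_sandwich[OF _ _ tendsto_const])
  show "(\<lambda>l. \<theta> ^ l / (2 * r)) \<longlonglongrightarrow> 0"
    using \<theta> by (intro tendsto_divide_zero LIMSEQ_power_zero) auto
qed (auto simp: prob_undecided_le)

text \<open>Fubini for the terms indexed by \<open>(\<alpha>, n)\<close>: for fixed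
  \<open>\<alpha>\<close> the binomial theorem gives \<open>word_weight q \<alpha>\<close>, and
  absolute values give the same with \<open>1 + q\<close>, so convergence is absolute. Summing over
  \<open>\<alpha>\<close> first yields the coefficients.\<close>

lemma series_coeff_sums_speed: "(\<lambda>n. (-1) ^ n * real_of_int (series_coeff n) * q ^ n) sums speed"
proof -
  define t :: "nat list \<Rightarrow> nat \<Rightarrow> real" where
    "t \<alpha> n = (-1) ^ n * (binom (length \<alpha>) (int n - int (height \<alpha>)) * (-1) ^ height \<alpha>) * q ^ n" for \<alpha> n
  have shift: "(g has_sum (\<Sum>k\<le>length \<alpha>. g (height \<alpha> + k))) UNIV"
    if "\<And>n. binom (length \<alpha>) (int n - int (height \<alpha>)) = 0 \<Longrightarrow> g n = 0" for g :: "nat \<Rightarrow> real" and \<alpha>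
  proof (rule has_sum_finite_neutralI)
    fix n assume n: "n \<in> UNIV - (\<lambda>k. height \<alpha> + k) ` {..length \<alpha>}"
    show "g n = 0"
    proof (rule that)
      have "\<not> (height \<alpha> \<le> n \<and> n - height \<alpha> \<le> length \<alpha>)"
      proof
        assume "height \<alpha> \<le> n \<and> n - height \<alpha> \<le> length \<alpha>"
        then have "n = height \<alpha> + (n - height \<alpha>)" "n - height \<alpha> \<in> {..length \<alpha>}" by auto
        then show False using n by blast
      qed
      then show "binom (length \<alpha>) (int n - int (height \<alpha>)) = 0"
        by (auto simp: binom_def binomial_eq_0_iff nat_diff_distrib')
    qed
  next
    show "(\<Sum>k\<le>length \<alpha>. g (height \<alpha> + k)) = sum g ((\<lambda>k. height \<alpha> + k) ` {..length \<alpha>})"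
      by (simp add: sum.reindex)
  qed auto
  have t_shift: "t \<alpha> (height \<alpha> + k) = q ^ height \<alpha> * ((length \<alpha> choose k) * (- q) ^ k)" for \<alpha> k
  proof -
    \<comment> \<open>The height enters both signs, so only the parity of \<open>k\<close>
      survives.\<close>
    have "(-1) ^ (height \<alpha> + k) * (-1) ^ height \<alpha> = ((-1) ^ k :: real)"
      by (simp add: power_add mult.commute mult.left_commute flip: power_mult_distrib)
    then have "t \<alpha> (height \<alpha> + k) = (-1) ^ k * (length \<alpha> choose k) * q ^ (height \<alpha> + k)"
      unfolding t_def by (simp add: binom_def algebra_simps)
    also have "\<dots> = q ^ height \<alpha> * ((length \<alpha> choose k) * (- q) ^ k)"
      by (subst (2) power_minus) (simp add: power_add)
    finally show ?thesis .
  qed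
  have row: "(t \<alpha> has_sum word_weight q \<alpha>) UNIV" for \<alpha>
  proof -
    have "(\<Sum>k\<le>length \<alpha>. t \<alpha> (height \<alpha> + k)) = q ^ height \<alpha> * (- q + 1) ^ length \<alpha>"
      unfolding t_shift binomial_ring sum_distrib_left by simp
    moreover have "(t \<alpha> has_sum (\<Sum>k\<le>length \<alpha>. t \<alpha> (height \<alpha> + k))) UNIV"
      by (rule shift) (simp add: t_def)
    ultimately show ?thesis by (simp add: word_weight_def mult.commute)
  qed
  have abs_row: "((\<lambda>n. norm (t \<alpha> n)) has_sum ((1 + q) ^ length \<alpha> * q ^ height \<alpha>)) UNIV" for \<alpha>
  proof -
    have "norm (t \<alpha> (height \<alpha> + k)) = q ^ height \<alpha> * ((length \<alpha> choose k) * q ^ k)" for k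
      using q_nonneg by (simp add: t_shift abs_mult power_abs)
    then have "(\<Sum>k\<le>length \<alpha>. norm (t \<alpha> (height \<alpha> + k))) = q ^ height \<alpha> * (q + 1) ^ length \<alpha>"
      unfolding binomial_ring sum_distrib_left by simp
    moreover have "((\<lambda>n. norm (t \<alpha> n)) has_sum (\<Sum>k\<le>length \<alpha>. norm (t \<alpha> (height \<alpha> + k)))) UNIV"
      by (rule shift) (simp add: t_def)
    ultimately show ?thesis by (simp add: mult.commute add.commute)
  qed
  have "Infinite_Sum.abs_summable_on (\<lambda>(\<alpha>, n). t \<alpha> n) (min_good_words \<times> UNIV)"
    unfolding Infinite_Sum.abs_summable_on_Sigma_iff
  proof (intro conjI ballI)
    fix \<alpha> show "Infinite_Sum.abs_summable_on (\<lambda>n. case (\<alpha>, n) of (\<alpha>, n) \<Rightarrow> t \<alpha> n) UNIV"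
      using abs_row[of \<alpha>] by (auto simp: summable_on_def)
  next
    have "(\<Sum>\<^sub>\<infinity>n. norm (t \<alpha> n)) = (1 + q) ^ length \<alpha> * q ^ height \<alpha>" for \<alpha>
      using abs_row by (rule infsumI)
    then show "Infinite_Sum.abs_summable_on (\<lambda>\<alpha>. \<Sum>\<^sub>\<infinity>n\<in>UNIV. norm (case (\<alpha>, n) of (\<alpha>, n) \<Rightarrow> t \<alpha> n)) min_good_words"
      using summable_min_good q_nonneg by (simp add: abs_mult power_abs)
  qed
  then have "(\<lambda>(\<alpha>, n). t \<alpha> n) summable_on (min_good_words \<times> UNIV)" by (rule abs_summable_summable)
  then have "((\<lambda>(\<alpha>, n). t \<alpha> n) has_sum speed) (min_good_words \<times> UNIV)"
    using row speed_has_sum by (intro has_sum_SigmaI[of _ _ _ "word_weight q"]) auto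
  then have "((\<lambda>(n, \<alpha>). t \<alpha> n) has_sum speed) (UNIV \<times> min_good_words)"
    by (subst (asm) has_sum_swap) simp
  then have "((\<lambda>n. (-1) ^ n * real_of_int (series_coeff n) * q ^ n) has_sum speed) UNIV"
  proof (rule has_sum_SigmaD)
    fix n :: nat
    let ?S = "{\<alpha> \<in> min_good_words. binom (length \<alpha>) (int n - int (height \<alpha>)) \<noteq> 0}"
    \<comment> \<open>A contributing word has height at most \<open>n\<close>, hence length and
      letters at most \<open>n + 1\<close>.\<close>
    have "finite ?S"
    proof (rule finite_subset)
      have member_le: "x - 1 \<le> height \<alpha>" if "x \<in> set \<alpha>" for x \<alpha> using that by (induction \<alpha>) auto
      show "?S \<subseteq> {\<alpha>. set \<alpha> \<subseteq> {..Suc n} \<and> length \<alpha> \<le> Suc n}"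
      proof
        fix \<alpha> assume \<alpha>: "\<alpha> \<in> ?S"
        then have "height \<alpha> \<le> n" by (auto simp: binom_def split: if_splits)
        moreover have "length \<alpha> \<le> Suc (height \<alpha>)" using \<alpha> min_good_words_length by auto
        ultimately show "\<alpha> \<in> {\<alpha>. set \<alpha> \<subseteq> {..Suc n} \<and> length \<alpha> \<le> Suc n}"
          using member_le[of _ \<alpha>] by fastforce
      qed
    qed (rule finite_lists_length_le, simp)
    then have "((\<lambda>\<alpha>. t \<alpha> n) has_sum (\<Sum>\<alpha>\<in>?S. t \<alpha> n)) min_good_words"
      by (rule has_sum_finite_neutralI) (auto simp: t_def)
    also have "(\<Sum>\<alpha>\<in>?S. t \<alpha> n) = (-1) ^ n * real_of_int (series_coeff n) * q ^ n"
      by (simp add: series_coeff_def t_def sum_distrib_left sum_distrib_right mult_ac)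
    finally show "((\<lambda>\<alpha>. case (n, \<alpha>) of (n, \<alpha>) \<Rightarrow> t \<alpha> n)
        has_sum (-1) ^ n * real_of_int (series_coeff n) * q ^ n) min_good_words" by simp
  qed
  then show ?thesis by (rule has_sum_imp_sums)
qed

end

section \<open>The front of the coupled bin model\<close>

abbreviation letters :: "(int \<times> int \<Rightarrow> bool) \<Rightarrow> nat \<Rightarrow> nat list" where
  "letters \<equiv> history (\<lambda>h. vertex_order (levels h))"

text \<open>The levels computed from the letters satisfy the recursion of longest paths; the summand
  \<open>1\<close> is the offset between level and bin.\<close>

lemma longest_path_front:
  assumes pos: "\<And>m. 0 \<notin> set (letters \<omega> m)" and n: "n > 0"
  shows "front (act (letters \<omega> n) (level_config [])) = int (longest_path \<omega> n) + 1"
proof -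
  define ls where "ls m = levels (letters \<omega> m)" for m
  define lev where "lev j = ls (nat j) ! (nat j - 1)" for j
  have len: "length (ls m) = m" for m by (simp add: ls_def)
  have grow: "ls (Suc m) ! i = ls m ! i" if "i < m" for i m
    using that by (simp add: ls_def nth_append)
  have nth: "i < m \<Longrightarrow> ls m ! i = ls (Suc i) ! i" for i m
  proof (induction m)
    case (Suc m)
    then show ?case by (cases "i = m") (simp_all add: grow)
  qed simp
  have lev: "lev j = ls m ! (nat j - 1)" if "1 \<le> j" "j \<le> int m" for j m
    using nth[of "nat j - 1" m] that by (simp add: lev_def)
  have step: "\<exists>k. \<omega> (vertex_order (ls m) k, int m + 1)
      \<and> (\<forall>k'. \<omega> (vertex_order (ls m) k', int m + 1) \<longrightarrow> k \<le> k')
      \<and> lev (int m + 1) = vertex_bin (ls m) (vertex_order (ls m) k)" for m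
  proof -
    let ?P = "\<lambda>k. \<omega> (vertex_order (ls m) k, int m + 1)"
    have "next_letter (\<lambda>h. vertex_order (levels h)) \<omega> (letters \<omega> m) \<noteq> 0"
      using pos[of "Suc m"] by auto
    then have ex: "\<exists>k. ?P k"
      and eq: "next_letter (\<lambda>h. vertex_order (levels h)) \<omega> (letters \<omega> m) = Suc (LEAST k. ?P k)"
      by (auto simp: next_letter_def ls_def split: if_splits)
    have "lev (int m + 1) = ls (Suc m) ! m" by (simp add: lev_def nat_add_distrib)
    also have "\<dots> = vertex_bin (ls m) (vertex_order (ls m) (LEAST k. ?P k))"
      using len[of m] eq by (simp add: ls_def nth_append)
    finally show ?thesis using LeastI_ex[OF ex] Least_le[of ?P] by blast
  qed
  have bin: "vertex_bin (ls m) i = Suc (lev i)" if "1 \<le> i" "i \<le> int m" for i m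
    using lev[OF that] that by (simp add: vertex_bin_def)
  have "longest_path \<omega> n = Max (lev ` {1..int n})"
  proof (rule longest_path_eq_Max_level[OF _ _ n])
    fix i j :: int assume ij: "1 \<le> i" "i < j" "\<omega> (i, j)"
    define m where "m = nat (j - 1)"
    have m: "j = int m + 1" using ij by (simp add: m_def)
    obtain k where k: "\<And>k'. \<omega> (vertex_order (ls m) k', j) \<Longrightarrow> k \<le> k'"
      "lev j = vertex_bin (ls m) (vertex_order (ls m) k)"
      using step[of m] m by auto
    obtain k' where "vertex_order (ls m) k' = i"
      using vertex_order_surj[of i "ls m"] ij m len by auto
    \<comment> \<open>Every earlier vertex occurs in the order, so the first edge found comes no
      later than the one from \<open>i\<close>, and bins decrease along the order.\<close>
    then have "vertex_bin (ls m) i \<le> lev j" using k ij vertex_bin_antimono[of k k' "ls m"] by auto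
    then show "lev i < lev j" using bin[of i m] ij m by simp
  next
    fix j :: int assume j: "1 \<le> j" "lev j \<noteq> 0"
    define m where "m = nat (j - 1)"
    have m: "j = int m + 1" using j by (simp add: m_def)
    obtain k where k: "\<omega> (vertex_order (ls m) k, j)" "lev j = vertex_bin (ls m) (vertex_order (ls m) k)"
      using step[of m] m by auto
    moreover have "vertex_order (ls m) k \<le> int m" using vertex_order_le[of "ls m" k] len by simp
    \<comment> \<open>Fictitious vertices have bin \<open>0\<close>, so a positive level forces a
      genuine predecessor.\<close>
    moreover have "1 \<le> vertex_order (ls m) k" using k j by (auto simp: vertex_bin_def split: if_splits)
    ultimately show "\<exists>i\<ge>1. i < j \<and> \<omega> (i, j) \<and> lev j = Suc (lev i)"
      using bin[of "vertex_order (ls m) k" m] m by (intro exI[of _ "vertex_order (ls m) k"]) auto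
  qed
  moreover have "lev ` {1..int n} = set (ls n)"
  proof
    show "lev ` {1..int n} \<subseteq> set (ls n)" using lev len by auto
    show "set (ls n) \<subseteq> lev ` {1..int n}"
    proof
      fix x assume "x \<in> set (ls n)"
      then obtain i where "i < n" "x = ls n ! i" using len[of n] by (auto simp: in_set_conv_nth)
      then show "x \<in> lev ` {1..int n}"
        using lev[of "int i + 1" n] by (intro image_eqI[of _ _ "int i + 1"]) (auto simp: nat_add_distrib)
    qed
  qed
  moreover have "ls n \<noteq> []" using len[of n] n by auto
  moreover have "level_config (ls n) = act (letters \<omega> n) (level_config [])" "level_config (ls n) \<in> configs"
    using level_config_levels[OF pos[of n]] unfolding ls_def by blast+
  ultimately show ?thesis using front_level_config[of "ls n"] by metis
qed

definition advances :: "nat list \<Rightarrow> bool" where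
  "advances v \<longleftrightarrow> front (act v (level_config [])) = front (act (tl v) (level_config [])) + 1"

lemma front_eq_sum_advances:
  assumes pos: "\<And>m. 0 \<notin> set (letters \<omega> m)"
  shows "front (act (letters \<omega> n) (level_config [])) = (\<Sum>i<n. of_bool (advances (letters \<omega> (Suc i))))"
proof (induction n)
  case (Suc n)
  let ?x = "next_letter (\<lambda>h. vertex_order (levels h)) \<omega> (letters \<omega> n)"
  have "?x \<ge> 1" using pos[of "Suc n"] by (auto simp: Suc_le_eq)
  then have "front (act (letters \<omega> (Suc n)) (level_config []))
      = front (act (letters \<omega> n) (level_config [])) + of_bool (advances (letters \<omega> (Suc n)))"
    using bin_move_front(2)[OF act_configs[OF level_config_Nil(1) pos[of n]], of ?x]
    by (auto simp: advances_def)
  then show ?case using Suc by simp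
qed (simp add: level_config_Nil)

text \<open>Each sum is completed to the sum of the first \<open>n + k\<close> terms by
  \<open>k\<close> terms from the unit interval.\<close>

lemma sum_shift_bound:
  fixes b :: "nat \<Rightarrow> real"
  assumes "\<And>i. 0 \<le> b i" "\<And>i. b i \<le> 1"
  shows "\<bar>(\<Sum>i<n. b (i + k)) - (\<Sum>i<n. b i)\<bar> \<le> k"
proof -
  have split: "(\<Sum>i<m + l. b i) = (\<Sum>i<m. b i) + (\<Sum>i<l. b (i + m))" for m l
    by (induction l) (simp_all add: add.commute)
  have bounds: "0 \<le> (\<Sum>i<k. b (i + m))" "(\<Sum>i<k. b (i + m)) \<le> k" for m
    using assms sum_bounded_above[of "{..<k}" "\<lambda>i. b (i + m)" 1] by (auto intro: sum_nonneg)
  show ?thesis using split[of k n] split[of n k] bounds[of 0] bounds[of n] by (simp add: add.commute abs_le_iff)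
qed

text \<open>First \<open>l\<close> is fixed so large that \<open>c l\<close> and \<open>d l\<close>
  are near their limits, then \<open>n\<close> grows.\<close>

lemma average_tendsto_squeeze:
  fixes S :: "nat \<Rightarrow> real" and A U :: "nat \<Rightarrow> nat \<Rightarrow> real"
  assumes lower: "\<And>l n. A l n - K l \<le> S n" and upper: "\<And>l n. S n \<le> A l n + U l n + K l"
    and A: "\<And>l. (\<lambda>n. A l n / n) \<longlonglongrightarrow> c l" and U: "\<And>l. (\<lambda>n. U l n / n) \<longlonglongrightarrow> d l"
    and c: "c \<longlonglongrightarrow> C" and d: "d \<longlonglongrightarrow> 0"
  shows "(\<lambda>n. S n / n) \<longlonglongrightarrow> C"
proof (rule tendstoI)
  fix e :: real assume e: "e > 0"
  have "\<forall>\<^sub>F l in sequentially. dist (c l) C < e / 4 \<and> dist (d l) 0 < e / 4"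
    using e by (intro eventually_conj tendstoD[OF c] tendstoD[OF d]) auto
  then obtain l where l: "dist (c l) C < e / 4" "dist (d l) 0 < e / 4"
    by (auto simp: eventually_sequentially)
  have K: "(\<lambda>n. K l / real n) \<longlonglongrightarrow> 0"
    by (rule tendsto_divide_0[OF tendsto_const filterlim_at_top_imp_at_infinity[OF filterlim_real_sequentially]])
  \<comment> \<open>The upper bound spends \<open>2 * (e / 4) + 3 * (e / 8)\<close>, which is below
    \<open>e\<close>.\<close>
  have e8: "e / 8 > 0" using e by simp
  from tendstoD[OF A[of l] e8] tendstoD[OF U[of l] e8] tendstoD[OF K e8] eventually_gt_at_top[of 0]
  show "\<forall>\<^sub>F n in sequentially. dist (S n / n) C < e"
  proof eventually_elim
    case (elim n)
    have "A l n / n - K l / n \<le> S n / n"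
      using divide_right_mono[OF lower[of l n], of "real n"] by (simp add: diff_divide_distrib)
    moreover have "S n / n \<le> A l n / n + U l n / n + K l / n"
      using divide_right_mono[OF upper[of n l], of "real n"] by (simp add: add_divide_distrib)
    ultimately show ?case using elim l unfolding dist_real_def by linarith
  qed
qed

context small_q
begin

text \<open>Up to a bounded shift, the front moves at least as often as a window starts with a
  minimal good word, and exceeds that count by at most the number of undecided windows. Both counts
  obey the law of large numbers.\<close>

lemma longest_path_tendsto:
  "AE \<omega> in barak_erdos_space (1 - q). (\<lambda>n. real (longest_path \<omega> n) / real n) \<longlonglongrightarrow> speed"
proof -
  interpret inspection "\<lambda>h. vertex_order (levels h)" "1 - q"
    using inj_vertex_order vertex_order_le[of "levels _"] q_nonneg q_less_1 by unfold_locales auto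
  have window: "window letter l i \<omega> = take l (letters \<omega> (i + l))" for l i \<omega>
  proof -
    have "rev [0..<i + l] = rev [i..<i + l] @ rev [0..<i]"
      using upt_add_eq_append[of 0 i l] by simp
    then show ?thesis unfolding window_def history_eq_map_letter by simp
  qed
  have expect: "expectation (\<lambda>\<omega>. of_bool (window letter l i \<omega> \<in> A)) = measure_pmf.prob (words l) A" for l i A
  proof -
    have "expectation (\<lambda>\<omega>. of_bool (window letter l i \<omega> \<in> A))
        = expectation (indicator {\<omega> \<in> space M. take l (letters \<omega> (i + l)) \<in> A})"
      unfolding window by (rule Bochner_Integration.integral_cong) (auto simp: indicator_def)
    also have "\<dots> = prob {\<omega> \<in> space M. take l (letters \<omega> (i + l)) \<in> A}"
      by (simp add: Int_absorb2 subset_eq)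
    finally show ?thesis by (simp add: prob_window)
  qed
  have slln: "AE \<omega> in M. \<forall>k. (\<lambda>n. (\<Sum>i<n. of_bool (take (Suc k) (letters \<omega> (i + Suc k)) \<in> A (Suc k))) / n)
      \<longlonglongrightarrow> measure_pmf.prob (words (Suc k)) (A (Suc k))" for A
    unfolding AE_all_countable window[symmetric]
    by (intro allI window_slln indep_letters expect) auto
  from AE_history_pos slln[of starts_min_good] slln[of undecided] show ?thesis
  proof eventually_elim
    case (elim \<omega>)
    define S :: "nat \<Rightarrow> real" where "S n = (\<Sum>i<n. of_bool (advances (letters \<omega> (Suc i))))" for n
    define A U :: "nat \<Rightarrow> nat \<Rightarrow> real" where
      "A k n = (\<Sum>i<n. of_bool (take (Suc k) (letters \<omega> (i + Suc k)) \<in> starts_min_good (Suc k)))" and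
      "U k n = (\<Sum>i<n. of_bool (take (Suc k) (letters \<omega> (i + Suc k)) \<in> undecided (Suc k)))" for k n
    have good: "advances v" if v: "0 \<notin> set v" "take l v \<in> starts_min_good l" for v l
    proof -
      obtain m where "take m (take l v) \<in> good_words"
        using v(2) by (auto simp: starts_min_good_def min_good_words_iff)
      then show ?thesis unfolding advances_def take_take
        using good_prefix_front_step[OF level_config_Nil(1) v(1)] by blast
    qed
    have decided: "take l v \<in> starts_min_good l" if v: "0 \<notin> set v" "advances v" "l \<le> length v" "take l v \<notin> undecided l" for v l
    proof -
      obtain m where "m \<le> l" "take m v \<in> min_good_words"
        using front_step_min_good_prefix[OF level_config_Nil(1) v(1), of l] v
        by (auto simp: undecided_def advances_def)
      then show ?thesis by (auto simp: starts_min_good_def min_absorb1)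
    qed
    \<comment> \<open>The window of length \<open>k + 1\<close> starting at \<open>i\<close> ends at
      step \<open>i + k + 1\<close>, hence the shift by \<open>k\<close>.\<close>
    have shift: "\<bar>(\<Sum>i<n. of_bool (advances (letters \<omega> (Suc (i + k))))) - S n\<bar> \<le> k" for k n
      unfolding S_def by (rule sum_shift_bound) auto
    have "(\<lambda>n. S n / n) \<longlonglongrightarrow> speed"
    proof (rule average_tendsto_squeeze)
      fix k n
      have "A k n \<le> (\<Sum>i<n. of_bool (advances (letters \<omega> (Suc (i + k)))))"
        unfolding A_def using good elim(1) by (intro sum_mono) (auto simp del: history.simps)
      then show "A k n - real k \<le> S n" using shift[of k n] by linarith
      have "(\<Sum>i<n. of_bool (advances (letters \<omega> (Suc (i + k))))) \<le> A k n + U k n"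
        unfolding A_def U_def sum.distrib[symmetric]
      proof (rule sum_mono)
        fix i
        show "of_bool (advances (letters \<omega> (Suc (i + k))))
            \<le> (of_bool (take (Suc k) (letters \<omega> (i + Suc k)) \<in> starts_min_good (Suc k))
              + of_bool (take (Suc k) (letters \<omega> (i + Suc k)) \<in> undecided (Suc k)) :: real)"
          using decided[of "letters \<omega> (i + Suc k)" "Suc k"] elim(1)
          by (auto simp del: history.simps simp: of_bool_def)
      qed
      then show "S n \<le> A k n + U k n + real k" using shift[of k n] by linarith
      show "(\<lambda>n. A k n / n) \<longlonglongrightarrow> measure_pmf.prob (words (Suc k)) (starts_min_good (Suc k))"
        using elim(2) by (simp add: A_def)
      show "(\<lambda>n. U k n / n) \<longlonglongrightarrow> measure_pmf.prob (words (Suc k)) (undecided (Suc k))"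
        using elim(3) by (simp add: U_def)
    next
      show "(\<lambda>k. measure_pmf.prob (words (Suc k)) (starts_min_good (Suc k))) \<longlonglongrightarrow> speed"
        by (rule LIMSEQ_Suc[OF prob_starts_min_good_tendsto])
      show "(\<lambda>k. measure_pmf.prob (words (Suc k)) (undecided (Suc k))) \<longlonglongrightarrow> 0"
        by (rule LIMSEQ_Suc[OF prob_undecided_tendsto])
    qed
    \<comment> \<open>The front exceeds the longest path by one, which disappears after division by
      \<open>n\<close>.\<close>
    then have "(\<lambda>n. S n / n - 1 / n) \<longlonglongrightarrow> speed - 0"
      by (intro tendsto_diff lim_1_over_n)
    then have lim: "(\<lambda>n. S n / n - 1 / n) \<longlonglongrightarrow> speed" by simp
    have ev: "S n / n - 1 / n = real (longest_path \<omega> n) / real n" if "n > 0" for n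
    proof -
      have "real_of_int (front (act (letters \<omega> n) (level_config []))) = S n"
        using front_eq_sum_advances[of \<omega> n] elim(1) by (simp add: S_def)
      then have "S n = real (longest_path \<omega> n) + 1"
        using longest_path_front[of \<omega> n] elim(1) that by simp
      then show ?thesis by (simp add: diff_divide_distrib[symmetric])
    qed
    show ?case
      by (rule Lim_transform_eventually[OF lim eventually_mono[OF eventually_gt_at_top[of 0]]]) (rule ev)
  qed
qed

lemma growth_rate_eq_speed: "growth_rate (1 - q) = speed"
  unfolding growth_rate_def
proof (rule the_equality)
  fix c assume "AE \<omega> in barak_erdos_space (1 - q). (\<lambda>n. real (longest_path \<omega> n) / real n) \<longlonglongrightarrow> c"
  with longest_path_tendsto have "AE \<omega> in barak_erdos_space (1 - q). c = speed"
    by eventually_elim (rule LIMSEQ_unique)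
  then show "c = speed" using prob_space.AE_const[OF prob_space_barak_erdos] by simp
qed (rule longest_path_tendsto)

end

theorem theorem4p8:
  fixes q :: real
  assumes "0 \<le> q" and "q < (sqrt 2 - 1) / 2"
  shows "(\<lambda>n. (-1) ^ n * real_of_int (series_coeff n) * q ^ n) sums growth_rate (1 - q)"
proof -
  \<comment> \<open>The bound on \<open>q\<close> says \<open>2 * q + 1 < sqrt 2\<close>; squaring
    gives the assumption of the locale.\<close>
  have "(2 * q + 1)\<^sup>2 < (sqrt 2)\<^sup>2"
    using assms by (intro power_strict_mono) auto
  then have "4 * q * (1 + q) < 1" by (simp add: power2_eq_square algebra_simps)
  then interpret small_q q using assms by unfold_locales
  show ?thesis using series_coeff_sums_speed by (simp add: growth_rate_eq_speed)
qed

end
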